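(* Let $M$ be a free $\mathbb{Z}$-module of rank $n$, $M_{\mathbb{R}}=M\otimes_{\mathbb{Z}}\mathbb{R}$, and let $P\subseteq M_{\mathbb{R}}$ be an $n$-dimensional lattice simplex. Assume that either $n=2$, or $n\ge 3$ and $\Gamma_P\ge \frac{2}{3}n-1$. If $L(P)\ge \Gamma_P+1$, then $P$ is integrally closed, i.e. $(P\cap M)+((rP)\cap M)=((r+1)P)\cap M$ for every positive integer $r$.
   Context: A lattice polytope in $M_{\mathbb{R}}$ is the convex hull of a finite subset of $M$; all polytopes are assumed full-dimensional. A lattice simplex is a full-dimensional lattice polytope with exactly $n+1$ vertices. Sums of sets are Minkowski sums and $rP=\{ru : u\in P\}$. Lattice length: for distinct vertices $u_i,u_j$ of $P$ with joining segment $e_{ij}$, put $l_{ij}=\#(e_{ij}\cap M)-1$; $L(P)$ is the minimum of $l_{ij}$ over all edges $e_{ij}$ of $P$. The invariant $\Gamma_P$: for a strictly convex rational polyhedral cone $Q\subseteq M_{\mathbb{R}}$ with primitive ray generators $w_1,\dots,w_s$, let $\beta_1,\dots,\beta_t$ be the (minimal) Hilbert basis of the affine semigroup $Q\cap M$. For $u\in Q\cap M$ define $\mathrm{ht}(u)=\max\{\sum_{i=1}^s a_i : u=\sum_{i=1}^s a_iw_i,\ a_i\in\mathbb{R}_{\ge 0}\}$ and $\mathrm{ord}(u)=\max\{\sum_{j=1}^t\lambda_j : u=\sum_{j=1}^t\lambda_j\beta_j,\ \lambda_j\in\mathbb{Z}_{\ge 0}\}$. Let $S_Q=\{\sum_{i=1}^s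 a_iw_i : 0\le a_i<1 \text{ for all } i\}$ and $\Gamma_Q=\max\{\mathrm{ht}(u)-\mathrm{ord}(u) : u\in S_Q\cap M\}$. For a lattice polytope $P$ with vertices $u_0,\dots,u_m$, let $C(P,u_i)$ be the cone generated by the vectors $u_j-u_i$, where $u_j$ runs over the vertices of $P$ adjacent to $u_i$. Then $\Gamma_P=\max\{\Gamma_{C(P,u_i)} : 0\le i\le m\}$. *)

theory Defs
  imports "HOL-Analysis.Analysis"
begin

text \<open>
  A free module \<open>M\<close> of rank \<open>n\<close>, sitting in \<open>M \<otimes> \<real>\<close>, is modelled as the integer span of a basis of
  a Euclidean space of dimension \<open>n\<close>. The metric of the ambient space plays no role.
\<close>

definition is_lattice :: "'a::euclidean_space set \<Rightarrow> bool" where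
  "is_lattice M \<longleftrightarrow>
     (\<exists>B. independent B \<and> span B = UNIV \<and>
          M = {\<Sum>b\<in>B. of_int (c b) *\<^sub>R b | c :: 'a \<Rightarrow> int. True})"

definition vertices :: "'a::euclidean_space set \<Rightarrow> 'a set" where
  "vertices P = {v. v extreme_point_of P}"

definition lattice_polytope :: "'a::euclidean_space set \<Rightarrow> 'a set \<Rightarrow> bool" where
  "lattice_polytope M P \<longleftrightarrow>
     (\<exists>S. finite S \<and> S \<subseteq> M \<and> P = convex hull S) \<and> aff_dim P = int DIM('a)"

definition lattice_simplex :: "'a::euclidean_space set \<Rightarrow> 'a set \<Rightarrow> bool" where
  "lattice_simplex M P \<longleftrightarrow> lattice_polytope M P \<and> card (vertices P) = DIM('a) + 1"

text \<open>Edges of a lattice polytope contain at least two lattice points, so the subtraction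
  on \<^typ>\<open>nat\<close> below does not truncate.\<close>

definition lattice_length :: "'a::euclidean_space set \<Rightarrow> 'a set \<Rightarrow> nat" where
  "lattice_length M e = card (e \<inter> M) - 1"

definition min_lattice_length :: "'a::euclidean_space set \<Rightarrow> 'a set \<Rightarrow> nat" where
  "min_lattice_length M P = Min {lattice_length M e | e. e edge_of P}"

definition primitive_vector :: "'a::euclidean_space set \<Rightarrow> 'a \<Rightarrow> bool" where
  "primitive_vector M w \<longleftrightarrow>
     w \<in> M \<and> w \<noteq> 0 \<and> (\<forall>u\<in>M. \<forall>k::int. w = of_int k *\<^sub>R u \<longrightarrow> \<bar>k\<bar> = 1)"

text \<open>The one-dimensional faces of a strictly convex cone are its rays.\<close>

definition ray_generators :: "'a::euclidean_space set \<Rightarrow> 'a set \<Rightarrow> 'a set" where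
  "ray_generators M Q = {w. primitive_vector M w \<and> (\<exists>R. R edge_of Q \<and> w \<in> R)}"

definition generates_monoid :: "'a::real_vector set \<Rightarrow> 'a set \<Rightarrow> bool" where
  "generates_monoid H A \<longleftrightarrow>
     finite H \<and> A = {\<Sum>h\<in>H. of_nat (c h) *\<^sub>R h | c :: 'a \<Rightarrow> nat. True}"

text \<open>The minimal finite generating set of \<open>Q \<inter> M\<close>; it exists and is unique when \<open>Q\<close> is a strictly
  convex rational polyhedral cone.\<close>

definition hilbert_basis :: "'a::euclidean_space set \<Rightarrow> 'a set \<Rightarrow> 'a set" where
  "hilbert_basis M Q =
     (THE H. generates_monoid H (Q \<inter> M) \<and> (\<forall>H'. H' \<subset> H \<longrightarrow> \<not> generates_monoid H' (Q \<inter> M)))"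

text \<open>For strictly convex \<open>Q\<close> and \<open>u \<in> Q \<inter> M\<close> the supremum in \<open>cone_ht\<close> is attained, and the set
  in \<open>cone_ord\<close> is finite.\<close>

definition cone_ht :: "'a::euclidean_space set \<Rightarrow> 'a set \<Rightarrow> 'a \<Rightarrow> real" where
  "cone_ht M Q u =
     Sup {\<Sum>w\<in>ray_generators M Q. a w | a :: 'a \<Rightarrow> real.
            (\<forall>w\<in>ray_generators M Q. 0 \<le> a w) \<and> u = (\<Sum>w\<in>ray_generators M Q. a w *\<^sub>R w)}"

definition cone_ord :: "'a::euclidean_space set \<Rightarrow> 'a set \<Rightarrow> 'a \<Rightarrow> nat" where
  "cone_ord M Q u =
     Max {\<Sum>b\<in>hilbert_basis M Q. l b | l :: 'a \<Rightarrow> nat.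
            u = (\<Sum>b\<in>hilbert_basis M Q. of_nat (l b) *\<^sub>R b)}"

definition fundamental_set :: "'a::euclidean_space set \<Rightarrow> 'a set \<Rightarrow> 'a set" where
  "fundamental_set M Q =
     {\<Sum>w\<in>ray_generators M Q. a w *\<^sub>R w | a :: 'a \<Rightarrow> real.
        \<forall>w\<in>ray_generators M Q. 0 \<le> a w \<and> a w < 1}"

definition Gamma_cone :: "'a::euclidean_space set \<Rightarrow> 'a set \<Rightarrow> real" where
  "Gamma_cone M Q =
     Max {cone_ht M Q u - real (cone_ord M Q u) | u. u \<in> fundamental_set M Q \<inter> M}"

definition vertex_cone :: "'a::euclidean_space set \<Rightarrow> 'a \<Rightarrow> 'a set" where
  "vertex_cone P u =
     convex_cone hull {v - u | v. v \<in> vertices P \<and> closed_segment u v edge_of P}"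

definition Gamma_polytope :: "'a::euclidean_space set \<Rightarrow> 'a set \<Rightarrow> real" where
  "Gamma_polytope M P = Max {Gamma_cone M (vertex_cone P u) | u. u \<in> vertices P}"

text \<open>Here \<open>+\<close> on sets is the Minkowski sum.\<close>

definition integrally_closed :: "'a::euclidean_space set \<Rightarrow> 'a set \<Rightarrow> bool" where
  "integrally_closed M P \<longleftrightarrow>
     (\<forall>r::nat. 0 < r \<longrightarrow>
        (P \<inter> M) + ((\<lambda>x. real r *\<^sub>R x) ` P \<inter> M) = (\<lambda>x. real (r + 1) *\<^sub>R x) ` P \<inter> M)"

end

theory Submission
  imports Defs
begin

text \<open>
  Write \<open>n\<close> for the dimension and \<open>L\<close> for the minimal lattice length of an edge. It is enough to
  split off one lattice point \<open>p\<close> of \<open>P\<close> from a lattice point \<open>u\<close> of \<open>k P\<close>, \<open>k \<ge> 2\<close>, so that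
  \<open>u - p\<close> lies in \<open>(k - 1) P\<close>. Let \<open>u = \<Sum> a\<^sub>v v\<close> with \<open>a\<^sub>v \<ge> 0\<close> and \<open>\<Sum> a\<^sub>v = k\<close>. If some
  \<open>a\<^sub>v \<ge> 1\<close>, then \<open>p = v\<close> works, so all \<open>a\<^sub>v\<close> may be taken smaller than \<open>1\<close>.

  For \<open>n \<ge> 3\<close> the hypotheses give \<open>L \<ge> \<Gamma> + 1\<close> and \<open>L \<ge> 2 n / 3\<close>. Let \<open>v\<^sub>0\<close> be a vertex whose
  coefficient \<open>\<alpha>\<close> is largest; then \<open>\<alpha> \<ge> k / (n + 1) \<ge> 2 / (n + 1) \<ge> 1 / L\<close>. Every edge at \<open>v\<^sub>0\<close> is
  \<open>l w\<close> with \<open>w\<close> primitive and \<open>l \<ge> L\<close>. On the cone at \<open>v\<^sub>0\<close> let the weight be the linear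
  functional with value \<open>1 / l\<close> on \<open>w\<close>, that is, with value \<open>1\<close> on every edge vector: a point \<open>x\<close> of
  the cone satisfies \<open>m v\<^sub>0 + x \<in> m P\<close> iff its weight is at most \<open>m\<close>. The point \<open>z = u - k v\<^sub>0\<close> has
  weight \<open>k - \<alpha>\<close>, and it must be written as a sum of two lattice points \<open>x\<close>, \<open>z - x\<close> of the cone
  with the weight of \<open>x\<close> in the window \<open>[1 - \<alpha>, 1]\<close>; then \<open>p = v\<^sub>0 + x\<close>
  (lemma \<open>split_cone_point\<close>).

  Separate \<open>z\<close> into generators \<open>w\<close>, one for each unit of the integer parts of its coordinates, and
  a point \<open>s\<close> of the half-open fundamental parallelepiped. The generators have weight at most
  \<open>1 / L \<le> \<alpha>\<close>, so adding them one at a time cannot jump over the window. The point \<open>s\<close> has \<open>n\<close>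
  coordinates smaller than \<open>1\<close>, hence weight at most \<open>n / L \<le> 3 / 2\<close>. It is a sum of elements of the
  Hilbert basis, and each of these has order \<open>1\<close>, hence height at most \<open>\<Gamma> + 1 \<le> L\<close> and weight at
  most \<open>1\<close>. From such pieces one can assemble a part of \<open>s\<close> which is all of \<open>s\<close> or has weight in
  \<open>[1 / 2, 1]\<close> (lemma \<open>split_fundamental_point\<close>). What remains of \<open>s\<close> has weight at most
  \<open>3 / 2 - 1 / 2 = 1\<close>, so this part and all generators together weigh at least
  \<open>k - \<alpha> - 1 \<ge> 1 - \<alpha>\<close>, and the generators lead into the window.

  For \<open>n = 2\<close> only \<open>k = 2\<close> is left. Then \<open>q = \<Sum> v - u\<close> is a lattice point of the triangle, and \<open>u\<close>
  lies in the double of one of the triangles obtained by replacing a vertex by \<open>q\<close>. These contain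
  fewer lattice points, so the descent ends (lemma \<open>split_triangle_point\<close>).

  Most of the other lemmas identify the invariants of the vertex cones: in a simplicial cone the
  rays are those of the given generators, the height is the sum of the coordinates, and the Hilbert
  basis consists of the irreducible lattice points.
\<close>

section \<open>Lattices\<close>

lemma lattice_add:
  assumes "is_lattice M" "x \<in> M" "y \<in> M"
  shows "x + y \<in> M"
proof -
  obtain B where B: "M = {\<Sum>b\<in>B. of_int (c b) *\<^sub>R b | c :: 'a \<Rightarrow> int. True}"
    using assms(1) unfolding is_lattice_def by auto
  obtain c d :: "'a \<Rightarrow> int"
    where "x = (\<Sum>b\<in>B. of_int (c b) *\<^sub>R b)" "y = (\<Sum>b\<in>B. of_int (d b) *\<^sub>R b)"
    using assms(2,3) B by auto
  then have "x + y = (\<Sum>b\<in>B. of_int (c b + d b) *\<^sub>R b)"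
    by (simp add: scaleR_add_left sum.distrib)
  then show ?thesis unfolding B by (intro CollectI exI[of _ "\<lambda>b. c b + d b"]) auto
qed

lemma lattice_minus:
  assumes "is_lattice M" "x \<in> M"
  shows "- x \<in> M"
proof -
  obtain B where B: "M = {\<Sum>b\<in>B. of_int (c b) *\<^sub>R b | c :: 'a \<Rightarrow> int. True}"
    using assms(1) unfolding is_lattice_def by auto
  obtain c :: "'a \<Rightarrow> int" where "x = (\<Sum>b\<in>B. of_int (c b) *\<^sub>R b)"
    using assms(2) B by auto
  then have "- x = (\<Sum>b\<in>B. of_int (- c b) *\<^sub>R b)"
    by (simp add: sum_negf)
  then show ?thesis unfolding B by (intro CollectI exI[of _ "\<lambda>b. - c b"]) auto
qed

lemma lattice_zero:
  assumes "is_lattice M"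
  shows "0 \<in> M"
proof -
  obtain B where B: "M = {\<Sum>b\<in>B. of_int (c b) *\<^sub>R b | c :: 'a \<Rightarrow> int. True}"
    using assms(1) unfolding is_lattice_def by auto
  then show ?thesis unfolding B by (intro CollectI exI[of _ "\<lambda>b. 0"]) auto
qed

lemma lattice_diff:
  assumes "is_lattice M" "x \<in> M" "y \<in> M"
  shows "x - y \<in> M"
  using lattice_add[OF assms(1,2) lattice_minus[OF assms(1,3)]] by simp

lemma lattice_sum:
  assumes "is_lattice M" "\<And>i. i \<in> I \<Longrightarrow> f i \<in> M"
  shows "sum f I \<in> M"
  using assms(2)
  by (induction I rule: infinite_finite_induct) (auto simp: lattice_zero lattice_add assms(1))

lemma lattice_scale_nat:
  assumes "is_lattice M" "x \<in> M"
  shows "of_nat k *\<^sub>R x \<in> M"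
  by (induction k) (auto simp: lattice_zero lattice_add assms algebra_simps)

lemma lattice_scale_int:
  assumes "is_lattice M" "x \<in> M"
  shows "of_int k *\<^sub>R x \<in> M"
proof (cases k rule: int_cases2)
  case (nonneg n)
  then show ?thesis using lattice_scale_nat[OF assms] by simp
next
  case (nonpos n)
  then show ?thesis using lattice_minus[OF assms(1) lattice_scale_nat[OF assms, of n]] by simp
qed

text \<open>
  The coordinates with respect to a lattice basis are linear, hence bounded on a bounded set, and on
  lattice points they are integers.
\<close>
lemma finite_bounded_lattice:
  assumes "is_lattice M" "bounded S"
  shows "finite (S \<inter> M)"
proof -
  obtain B where B: "independent B" "span B = UNIV"
     "M = {\<Sum>b\<in>B. of_int (c b) *\<^sub>R b | c :: 'a \<Rightarrow> int. True}"
    using assms(1) unfolding is_lattice_def by auto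
  have fB: "finite B" using B(1) by (rule independent_imp_finite)
  have rep: "representation B (\<Sum>b\<in>B. f b *\<^sub>R b) b = f b" if "b \<in> B" for f b
    using B that
    by (simp add: representation_sum representation_scale representation_basis if_distrib fB
        cong: if_cong)
  have lin: "bounded_linear (\<lambda>v. representation B v b)" for b
    by (intro linear_conv_bounded_linear[THEN iffD1] linearI)
      (use B in \<open>auto simp: representation_add representation_scale\<close>)
  have "\<exists>K::int. \<forall>x\<in>S. \<forall>b\<in>B. \<bar>representation B x b\<bar> \<le> of_int K"
  proof -
    have "\<exists>K. \<forall>x\<in>S. \<bar>representation B x b\<bar> \<le> K" for b
      using bounded_linear_image[OF assms(2) lin[of b]] by (auto simp: bounded_iff)
    then obtain K where K: "\<And>b x. x \<in> S \<Longrightarrow> \<bar>representation B x b\<bar> \<le> K b" by metis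
    show ?thesis
    proof (intro exI[of _ "\<Sum>b\<in>B. \<lceil>\<bar>K b\<bar>\<rceil>"] ballI)
      fix x b assume xb: "x \<in> S" "b \<in> B"
      have nonneg: "0 \<le> \<lceil>\<bar>K b\<bar>\<rceil>" for b
        using ceiling_mono[of 0 "\<bar>K b\<bar>"] by simp
      have "\<bar>representation B x b\<bar> \<le> of_int \<lceil>\<bar>K b\<bar>\<rceil>" using K[OF xb(1), of b] by linarith
      also have "\<dots> \<le> of_int (\<Sum>b\<in>B. \<lceil>\<bar>K b\<bar>\<rceil>)"
        unfolding of_int_le_iff
        by (rule member_le_sum) (use xb fB nonneg in auto)
      finally show "\<bar>representation B x b\<bar> \<le> of_int (\<Sum>b\<in>B. \<lceil>\<bar>K b\<bar>\<rceil>)" .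
    qed
  qed
  then obtain K :: int where K: "\<And>x b. x \<in> S \<Longrightarrow> b \<in> B \<Longrightarrow> \<bar>representation B x b\<bar> \<le> of_int K"
    by blast
  have "S \<inter> M \<subseteq> (\<lambda>c. \<Sum>b\<in>B. of_int (c b) *\<^sub>R b) ` (B \<rightarrow>\<^sub>E {-K..K})"
  proof
    fix x assume x: "x \<in> S \<inter> M"
    then obtain c :: "'a \<Rightarrow> int" where c: "x = (\<Sum>b\<in>B. of_int (c b) *\<^sub>R b)"
      using B(3) by auto
    have "restrict c B \<in> B \<rightarrow>\<^sub>E {-K..K}"
    proof (intro restrict_PiE_iff[THEN iffD2] ballI)
      fix b assume b: "b \<in> B"
      have "\<bar>of_int (c b)\<bar> \<le> (of_int K :: real)"
        using K[of x b] rep[OF b, of "\<lambda>b. of_int (c b)"] x b c by simp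
      then show "c b \<in> {-K..K}" by auto
    qed
    moreover have "x = (\<Sum>b\<in>B. of_int (restrict c B b) *\<^sub>R b)" using c by simp
    ultimately show "x \<in> (\<lambda>c. \<Sum>b\<in>B. of_int (c b) *\<^sub>R b) ` (B \<rightarrow>\<^sub>E {-K..K})" by blast
  qed
  then show ?thesis
    using fB by (meson finite_PiE finite_atLeastAtMost_int finite_imageI finite_subset)
qed

text \<open>
  The real numbers \<open>s\<close> with \<open>s x \<in> M\<close> form a discrete subgroup, so they are the multiples of the
  least positive one. This makes primitivity, which only forbids integral divisors, usable
  for real multiples.
\<close>
lemma lattice_points_on_line:
  assumes M: "is_lattice M" and x: "x \<in> M" "x \<noteq> 0"
  obtains t where "t > 0" "t *\<^sub>R x \<in> M" "\<And>s. s *\<^sub>R x \<in> M \<Longrightarrow> \<exists>j::int. s = of_int j * t"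
proof -
  let ?T = "{t. 0 < t \<and> t \<le> 1 \<and> t *\<^sub>R x \<in> M}"
  have "(\<lambda>t. t *\<^sub>R x) ` ?T \<subseteq> cball 0 (norm x) \<inter> M"
    using mult_right_mono[of _ 1 "norm x"] by auto
  then have "finite ((\<lambda>t. t *\<^sub>R x) ` ?T)"
    using finite_bounded_lattice[OF M bounded_cball] by (rule finite_subset)
  moreover have "inj_on (\<lambda>t. t *\<^sub>R x) ?T" using x(2) by (auto simp: inj_on_def)
  ultimately have fin: "finite ?T" by (rule finite_imageD)
  have ne: "1 \<in> ?T" using x by auto
  define t where "t = Min ?T"
  have tT: "t \<in> ?T" unfolding t_def using fin ne by (intro Min_in) auto
  have tmin: "t \<le> s" if "s \<in> ?T" for s unfolding t_def using fin that by (rule Min_le)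
  show thesis
  proof
    show "t > 0" "t *\<^sub>R x \<in> M" using tT by auto
    fix s assume s: "s *\<^sub>R x \<in> M"
    define j where "j = \<lfloor>s / t\<rfloor>"
    define r where "r = s - of_int j * t"
    have "of_int j \<le> s / t" "s / t < of_int j + 1" unfolding j_def by linarith+
    then have r: "0 \<le> r" "r < t" using \<open>t > 0\<close> unfolding r_def by (auto simp: field_simps)
    have "r *\<^sub>R x = s *\<^sub>R x - of_int j *\<^sub>R (t *\<^sub>R x)" unfolding r_def by (simp add: algebra_simps)
    then have "r *\<^sub>R x \<in> M"
      using lattice_diff[OF M s lattice_scale_int[OF M \<open>t *\<^sub>R x \<in> M\<close>]] by simp
    then have "r = 0" using tmin[of r] r tT by force
    then show "\<exists>j::int. s = of_int j * t" unfolding r_def by auto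
  qed
qed

lemma primitive_vector_multiples:
  assumes M: "is_lattice M" and w: "primitive_vector M w" and s: "s *\<^sub>R w \<in> M"
  shows "s \<in> \<int>"
proof -
  have wM: "w \<in> M" "w \<noteq> 0" using w unfolding primitive_vector_def by auto
  obtain t where t: "t > 0" "t *\<^sub>R w \<in> M" "\<And>s. s *\<^sub>R w \<in> M \<Longrightarrow> \<exists>j::int. s = of_int j * t"
    using lattice_points_on_line[OF M wM] by blast
  obtain j :: int where j: "1 = of_int j * t" using t(3)[of 1] wM by auto
  have "w = of_int j *\<^sub>R (t *\<^sub>R w)" using j by simp
  then have "\<bar>j\<bar> = 1" using w t(2) unfolding primitive_vector_def by blast
  moreover have "j > 0" using j t(1) by (metis of_int_pos mult_pos_pos of_int_0_less_iff zero_less_mult_pos2 zero_less_one)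
  ultimately have "t = 1" using j by auto
  then show ?thesis using t(3)[OF s] by auto
qed

lemma primitive_vectors_same_ray:
  assumes M: "is_lattice M" and w: "primitive_vector M w" "primitive_vector M (s *\<^sub>R w)" and "s > 0"
  shows "s = 1"
proof -
  have "s *\<^sub>R w \<in> M" "w \<in> M" using w unfolding primitive_vector_def by auto
  then obtain j where j: "s = of_int j"
    using primitive_vector_multiples[OF M w(1)] by (auto elim: Ints_cases)
  then have "\<bar>j\<bar> = 1" using w(2) \<open>w \<in> M\<close> unfolding primitive_vector_def by blast
  then show ?thesis using j \<open>s > 0\<close> by auto
qed

text \<open>
  The lattice points of the segment are among the points \<open>u + i w\<close> with \<open>0 \<le> i \<le> l\<close>. The resulting
  inequality transfers the lower bound on lattice lengths to the multiplicity \<open>l\<close> of every edge.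
\<close>
lemma lattice_segment_primitive:
  assumes M: "is_lattice M" and uv: "u \<in> M" "v \<in> M" "u \<noteq> v"
  obtains w l where "primitive_vector M w" "v - u = real l *\<^sub>R w" "0 < l"
    "lattice_length M (closed_segment u v) \<le> l"
proof -
  define x where "x = v - u"
  have x: "x \<in> M" "x \<noteq> 0" using lattice_diff[OF M uv(2,1)] uv(3) unfolding x_def by auto
  obtain t where t: "t > 0" "t *\<^sub>R x \<in> M" "\<And>s. s *\<^sub>R x \<in> M \<Longrightarrow> \<exists>j::int. s = of_int j * t"
    using lattice_points_on_line[OF M x] by blast
  obtain j :: int where j: "1 = of_int j * t" using t(3)[of 1] x by auto
  have jpos: "j > 0"
    using j t(1) by (metis of_int_0_less_iff zero_less_mult_pos2 zero_less_one)
  define l where "l = nat j"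
  have lt: "real l * t = 1" "0 < l" using j jpos unfolding l_def by auto
  define w where "w = t *\<^sub>R x"
  have xw: "x = real l *\<^sub>R w" unfolding w_def using lt by simp
  have prim: "primitive_vector M w"
    unfolding primitive_vector_def
  proof (intro conjI ballI allI impI)
    show "w \<in> M" "w \<noteq> 0" using t x unfolding w_def by auto
    fix y k assume y: "y \<in> M" "w = of_int k *\<^sub>R y"
    have "k \<noteq> 0" using \<open>w \<noteq> 0\<close> y(2) by auto
    then have "y = (t / of_int k) *\<^sub>R x" using y(2) unfolding w_def
      by (metis divide_inverse_commute of_int_0_eq_iff scaleR_left_imp_eq scaleR_scaleR times_divide_eq_right
          nonzero_mult_div_cancel_left)
    then obtain i :: int where "t / of_int k = of_int i * t" using t(3)[of "t / of_int k"] y(1) by auto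
    then have "(1::real) = of_int (i * k)" using t(1) \<open>k \<noteq> 0\<close> by (simp add: field_simps)
    then have "i * k = 1" by linarith
    then show "\<bar>k\<bar> = 1" by (metis abs_1 abs_mult_pos' mult.commute zdvd1_eq dvd_triv_right)
  qed
  have "closed_segment u v \<inter> M \<subseteq> (\<lambda>i. u + real i *\<^sub>R w) ` {0..l}"
  proof
    fix y assume y: "y \<in> closed_segment u v \<inter> M"
    then obtain s where s: "0 \<le> s" "s \<le> 1" "y = (1 - s) *\<^sub>R u + s *\<^sub>R v"
      by (auto simp: in_segment)
    have ys: "y = u + s *\<^sub>R x" using s(3) unfolding x_def by (simp add: algebra_simps)
    then have "s *\<^sub>R x \<in> M" using lattice_diff[OF M, of y u] y uv by simp
    then obtain i :: int where i: "s = of_int i * t" using t(3) by blast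
    have "0 \<le> i" using i s(1) t(1) by (simp add: zero_le_mult_iff)
    have "of_int i * t \<le> real l * t" using i s(2) lt by simp
    then have "i \<le> int l" using t(1) by simp
    have "y = u + real (nat i) *\<^sub>R w" using ys i \<open>0 \<le> i\<close> unfolding w_def by simp
    moreover have "nat i \<in> {0..l}" using \<open>i \<le> int l\<close> by auto
    ultimately show "y \<in> (\<lambda>i. u + real i *\<^sub>R w) ` {0..l}" by blast
  qed
  then have "card (closed_segment u v \<inter> M) \<le> card {0..l}"
    by (meson card_image_le card_mono finite_atLeastAtMost finite_imageI le_trans)
  then have "lattice_length M (closed_segment u v) \<le> l"
    unfolding lattice_length_def by simp
  then show thesis using that prim xw lt unfolding x_def by blast
qed

section \<open>Simplicial cones\<close>

text \<open>
  The basis \<open>W\<close> consists of the primitive ray vectors, the vectors to which height and fundamental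
  set refer; it need not generate \<open>M\<close>.
\<close>
locale simplicial_cone =
  fixes M W :: "'a::euclidean_space set"
  assumes lattice: "is_lattice M"
    and indep: "independent W"
    and spanning: "span W = UNIV"
    and primitive: "\<And>w. w \<in> W \<Longrightarrow> primitive_vector M w"
begin

definition coord :: "'a \<Rightarrow> 'a \<Rightarrow> real" where
  "coord w x = representation W x w"

definition Q :: "'a set" where
  "Q = {x. \<forall>w\<in>W. 0 \<le> coord w x}"

definition ht :: "'a \<Rightarrow> real" where
  "ht x = (\<Sum>w\<in>W. coord w x)"

lemma finite_W: "finite W"
  using indep by (rule independent_imp_finite)

lemma W_in_M: "w \<in> W \<Longrightarrow> w \<in> M"
  using primitive unfolding primitive_vector_def by blast

lemma coord_add: "coord w (x + y) = coord w x + coord w y"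
  unfolding coord_def by (simp add: representation_add indep spanning)

lemma coord_diff: "coord w (x - y) = coord w x - coord w y"
  unfolding coord_def by (simp add: representation_diff indep spanning)

lemma coord_zero: "coord w 0 = 0"
  unfolding coord_def by (simp add: representation_zero)

lemma coord_scale: "coord w (c *\<^sub>R x) = c * coord w x"
  unfolding coord_def by (simp add: representation_scale indep spanning)

lemma coord_sum: "coord w (sum f I) = (\<Sum>i\<in>I. coord w (f i))"
  by (induction I rule: infinite_finite_induct) (auto simp: coord_zero coord_add)

lemma coord_W: "v \<in> W \<Longrightarrow> coord w v = (if w = v then 1 else 0)"
  unfolding coord_def using representation_basis[OF indep] by simp

lemma coord_expansion: "(\<Sum>w\<in>W. coord w x *\<^sub>R w) = x"
  unfolding coord_def using sum_representation_eq[OF indep] spanning finite_W by auto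

lemma coord_combination: "w \<in> W \<Longrightarrow> coord w (\<Sum>v\<in>W. a v *\<^sub>R v) = a w"
  by (simp add: coord_sum coord_scale coord_W finite_W if_distrib cong: if_cong)

lemma coord_inject: "(\<And>w. w \<in> W \<Longrightarrow> coord w x = coord w y) \<Longrightarrow> x = y"
  by (metis (no_types, lifting) coord_expansion sum.cong)

lemma Q_add: "x \<in> Q \<Longrightarrow> y \<in> Q \<Longrightarrow> x + y \<in> Q"
  unfolding Q_def by (auto simp: coord_add)

lemma Q_scale: "x \<in> Q \<Longrightarrow> 0 \<le> c \<Longrightarrow> c *\<^sub>R x \<in> Q"
  unfolding Q_def by (auto simp: coord_scale)

lemma zero_in_Q: "0 \<in> Q"
  unfolding Q_def by (auto simp: coord_zero)

lemma W_in_Q: "w \<in> W \<Longrightarrow> w \<in> Q"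
  unfolding Q_def by (auto simp: coord_W)

lemma Q_pointed: "x \<in> Q \<Longrightarrow> - x \<in> Q \<Longrightarrow> x = 0"
  by (rule coord_inject) (use coord_diff[of _ 0] in \<open>force simp: Q_def coord_zero\<close>)

lemma convex_cone_hull_W: "convex_cone hull W = Q"
proof (rule hull_unique)
  show "W \<subseteq> Q" using W_in_Q by blast
  show "convex_cone Q" unfolding convex_cone_iff using zero_in_Q Q_add Q_scale by blast
  fix C assume C: "W \<subseteq> C" "convex_cone C"
  show "Q \<subseteq> C"
  proof
    fix x assume x: "x \<in> Q"
    have "(\<Sum>w\<in>V. coord w x *\<^sub>R w) \<in> C" if "V \<subseteq> W" for V
      using finite_subset[OF that finite_W] that
      by (induction V rule: finite_induct)
        (use C x in \<open>auto simp: convex_cone_contains_0 Q_def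
           intro!: convex_cone_add convex_cone_scaleR\<close>)
    from this[of W] show "x \<in> C" by (simp add: coord_expansion)
  qed
qed

text \<open>
  The ray is cut out of the cone by the vanishing of the other coordinates, which are nonnegative on
  the cone; so it is a face.
\<close>
lemma ray_edge_of_Q:
  assumes w: "w \<in> W"
  shows "{c *\<^sub>R w | c. 0 \<le> c} edge_of Q"
  unfolding edge_of_def
proof
  let ?R = "{c *\<^sub>R w | c. 0 \<le> c}"
  have R_iff: "x \<in> ?R \<longleftrightarrow> x \<in> Q \<and> (\<forall>v\<in>W - {w}. coord v x = 0)" for x
  proof
    assume "x \<in> ?R"
    then show "x \<in> Q \<and> (\<forall>v\<in>W - {w}. coord v x = 0)"
      using w by (auto simp: Q_scale W_in_Q coord_scale coord_W split: if_splits)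
  next
    assume x: "x \<in> Q \<and> (\<forall>v\<in>W - {w}. coord v x = 0)"
    have "x = coord w x *\<^sub>R w"
      by (rule coord_inject) (use x w in \<open>auto simp: coord_scale coord_W\<close>)
    then show "x \<in> ?R" using x w unfolding Q_def by blast
  qed
  show "?R face_of Q"
    unfolding face_of_def
  proof (intro conjI ballI impI)
    show "?R \<subseteq> Q" using R_iff by blast
    have "?R = (\<lambda>c. c *\<^sub>R w) ` {0..}" by auto
    then show "convex ?R" by (simp add: convex_scaled)
    fix a b x assume a: "a \<in> Q" and b: "b \<in> Q" and x: "x \<in> ?R" and seg: "x \<in> open_segment a b"
    obtain s where s: "0 < s" "s < 1" "x = (1 - s) *\<^sub>R a + s *\<^sub>R b"
      using seg by (auto simp: in_segment)
    have "coord v a = 0 \<and> coord v b = 0" if v: "v \<in> W - {w}" for v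
    proof -
      have "(1 - s) * coord v a + s * coord v b = 0"
        using x v s(3) unfolding R_iff by (simp add: coord_add coord_scale)
      moreover have "0 \<le> coord v a" "0 \<le> coord v b" using a b v unfolding Q_def by auto
      ultimately show ?thesis using s(1,2)
        by (smt (verit) mult_nonneg_nonneg mult_pos_pos)
    qed
    then show "a \<in> ?R" "b \<in> ?R" unfolding R_iff using a b by auto
  qed
  have "w \<noteq> 0" using w primitive unfolding primitive_vector_def by blast
  have "0 \<in> ?R" by (intro CollectI exI[of _ 0]) auto
  moreover have "span ?R = span {w}"
  proof (rule span_eq[THEN iffD2], intro conjI)
    show "?R \<subseteq> span {w}" by (auto intro: span_scale span_base)
    have "w \<in> ?R" by (intro CollectI exI[of _ 1]) auto
    then show "{w} \<subseteq> span ?R" by (auto intro: span_base)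
  qed
  then have "dim ?R = dim {w}" by (rule span_eq_dim)
  then have "dim ?R = 1" using \<open>w \<noteq> 0\<close> by simp
  ultimately show "aff_dim ?R = 1" using aff_dim_zero[of ?R] by (simp add: hull_inc)
qed

text \<open>
  If two coordinates of \<open>x\<close> were positive, both multiples of the corresponding generators could be
  split off from \<open>x\<close> inside the cone. A face contains the summands of its points, so it would contain
  two independent vectors as well as the origin.
\<close>
lemma edge_of_Q_subset_ray:
  assumes R: "R edge_of Q" and x: "x \<in> R" "x \<noteq> 0"
  shows "\<exists>w\<in>W. \<exists>c>0. x = c *\<^sub>R w"
proof -
  have face: "R face_of Q" and dim1: "aff_dim R = 1" using R unfolding edge_of_def by auto
  have xQ: "x \<in> Q" using face x(1) face_of_imp_subset by blast
  \<comment> \<open>\<open>x\<close> is the midpoint of \<open>2 y\<close> and \<open>2 (x - y)\<close>; the exception \<open>x = 2 y\<close> is where this segment degenerates\<close>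
  have summand: "y \<in> R" if y: "y \<in> Q" "x - y \<in> Q" "x \<noteq> 2 *\<^sub>R y" for y
  proof -
    have "x = (1 - 1/2) *\<^sub>R (2 *\<^sub>R y) + (1/2) *\<^sub>R (2 *\<^sub>R (x - y))" by (simp add: algebra_simps)
    moreover have "2 *\<^sub>R y \<noteq> 2 *\<^sub>R (x - y)"
    proof
      assume "2 *\<^sub>R y = 2 *\<^sub>R (x - y)"
      then have "y = x - y" by simp
      then have "y + y = x" by (simp add: eq_diff_eq)
      then show False using y(3) by (simp add: scaleR_2)
    qed
    ultimately have seg: "x \<in> open_segment (2 *\<^sub>R y) (2 *\<^sub>R (x - y))"
      unfolding in_segment by (intro conjI exI[of _ "1/2"]) auto
    then have y2: "2 *\<^sub>R y \<in> R"
      using face_ofD[OF face] x(1) y Q_scale by (meson zero_le_numeral)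
    have zero: "0 \<in> R"
    proof -
      have "x \<in> open_segment 0 (2 *\<^sub>R x)"
        using x(2) unfolding in_segment by (intro conjI exI[of _ "1/2"]) auto
      then show ?thesis using face_ofD[OF face] x(1) zero_in_Q xQ Q_scale by (meson zero_le_numeral)
    qed
    have "convex R" using face by (rule face_of_imp_convex)
    then have "(1/2) *\<^sub>R (2 *\<^sub>R y) + (1/2) *\<^sub>R 0 \<in> R"
      using y2 zero by (intro convexD) auto
    then show ?thesis by simp
  qed
  have zero: "0 \<in> R" using summand[of 0] x zero_in_Q xQ by simp
  have dimR: "dim R = 1" using aff_dim_zero[of R] dim1 zero by (simp add: hull_inc)
  obtain w where w: "w \<in> W" "coord w x \<noteq> 0"
    using coord_inject[of x 0] x(2) by (auto simp: coord_zero)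
  have wpos: "coord w x > 0" using w xQ unfolding Q_def by force
  have "coord v x = 0" if v: "v \<in> W" "v \<noteq> w" for v
  proof (rule ccontr)
    assume "coord v x \<noteq> 0"
    then have vpos: "coord v x > 0" using v xQ unfolding Q_def by force
    \<comment> \<open>a third instead of the whole coordinate, so that \<open>x\<close> is not \<open>2 a\<close>\<close>
    define a where "a = (coord w x / 3) *\<^sub>R w"
    define b where "b = (coord v x / 3) *\<^sub>R v"
    have "a \<in> R"
    proof (rule summand)
      show "a \<in> Q" unfolding a_def using Q_scale[OF W_in_Q[OF w(1)]] wpos by simp
      show "x - a \<in> Q" using xQ w unfolding Q_def a_def
        by (auto simp: coord_diff coord_scale coord_W)
      show "x \<noteq> 2 *\<^sub>R a"
      proof
        assume "x = 2 *\<^sub>R a"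
        then have "coord w x = coord w (2 *\<^sub>R a)" by simp
        also have "\<dots> = 2 / 3 * coord w x" unfolding a_def using w(1) by (simp only: coord_scale coord_W) simp
        finally show False using wpos by simp
      qed
    qed
    moreover have "b \<in> R"
    proof (rule summand)
      show "b \<in> Q" unfolding b_def using Q_scale[OF W_in_Q[OF v(1)]] vpos by simp
      show "x - b \<in> Q" using xQ v unfolding Q_def b_def
        by (auto simp: coord_diff coord_scale coord_W)
      show "x \<noteq> 2 *\<^sub>R b"
      proof
        assume "x = 2 *\<^sub>R b"
        then have "coord v x = coord v (2 *\<^sub>R b)" by simp
        also have "\<dots> = 2 / 3 * coord v x" unfolding b_def using v(1) by (simp only: coord_scale coord_W) simp
        finally show False using vpos by simp
      qed
    qed
    ultimately have "(3 / coord w x) *\<^sub>R a \<in> span R" "(3 / coord v x) *\<^sub>R b \<in> span R"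
      by (auto intro: span_scale span_base)
    then have "{w, v} \<subseteq> span R"
      using wpos vpos unfolding a_def b_def by simp
    moreover have "independent {w, v}" using indep w v by (meson dependent_mono empty_subsetI insert_subset)
    ultimately have "card {w, v} \<le> dim R" by (metis dim_span independent_card_le_dim)
    then show False using dimR v by simp
  qed
  then have "x = coord w x *\<^sub>R w"
    by (intro coord_inject) (use w in \<open>auto simp: coord_scale coord_W\<close>)
  then show ?thesis using w wpos by blast
qed

lemma ray_generators_Q: "ray_generators M Q = W"
proof
  show "W \<subseteq> ray_generators M Q"
  proof
    fix w assume w: "w \<in> W"
    moreover have "w \<in> {c *\<^sub>R w | c. 0 \<le> c}" by (intro CollectI exI[of _ 1]) auto
    ultimately show "w \<in> ray_generators M Q"
      unfolding ray_generators_def using primitive ray_edge_of_Q by blast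
  qed
  show "ray_generators M Q \<subseteq> W"
  proof
    fix x assume "x \<in> ray_generators M Q"
    then obtain R where x: "primitive_vector M x" "R edge_of Q" "x \<in> R"
      unfolding ray_generators_def by auto
    moreover have "x \<noteq> 0" using x(1) unfolding primitive_vector_def by auto
    ultimately obtain w c where w: "w \<in> W" "c > 0" "x = c *\<^sub>R w"
      using edge_of_Q_subset_ray by blast
    then have "c = 1" using primitive_vectors_same_ray[OF lattice primitive] x(1) by blast
    then show "x \<in> W" using w by simp
  qed
qed

lemma cone_ht_Q: "x \<in> Q \<Longrightarrow> cone_ht M Q x = ht x"
proof -
  assume x: "x \<in> Q"
  have "{\<Sum>w\<in>W. a w | a. (\<forall>w\<in>W. 0 \<le> a w) \<and> x = (\<Sum>w\<in>W. a w *\<^sub>R w)} = {ht x}" (is "?S = _")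
  proof
    show "?S \<subseteq> {ht x}" unfolding ht_def by (auto simp: coord_combination intro!: sum.cong)
    have "ht x \<in> ?S" unfolding ht_def
      by (intro CollectI exI[of _ "\<lambda>w. coord w x"]) (use x in \<open>auto simp: coord_expansion Q_def\<close>)
    then show "{ht x} \<subseteq> ?S" by blast
  qed
  then show ?thesis unfolding cone_ht_def ray_generators_Q by simp
qed

lemma fundamental_set_Q: "fundamental_set M Q = {x \<in> Q. \<forall>w\<in>W. coord w x < 1}"
proof
  show "fundamental_set M Q \<subseteq> {x \<in> Q. \<forall>w\<in>W. coord w x < 1}"
    unfolding fundamental_set_def ray_generators_Q unfolding Q_def by (auto simp: coord_combination)
  show "{x \<in> Q. \<forall>w\<in>W. coord w x < 1} \<subseteq> fundamental_set M Q"
  proof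
    fix x assume "x \<in> {x \<in> Q. \<forall>w\<in>W. coord w x < 1}"
    then show "x \<in> fundamental_set M Q"
      unfolding fundamental_set_def ray_generators_Q unfolding Q_def
      by (intro CollectI exI[of _ "\<lambda>w. coord w x"]) (auto simp: coord_expansion)
  qed
qed

lemma finite_box: "finite ({x \<in> Q. \<forall>w\<in>W. coord w x \<le> k w} \<inter> M)"
proof (rule finite_bounded_lattice[OF lattice])
  show "bounded {x \<in> Q. \<forall>w\<in>W. coord w x \<le> k w}"
  proof (rule boundedI)
    fix x assume x: "x \<in> {x \<in> Q. \<forall>w\<in>W. coord w x \<le> k w}"
    have "norm x \<le> (\<Sum>w\<in>W. norm (coord w x *\<^sub>R w))"
      using norm_sum[of "\<lambda>w. coord w x *\<^sub>R w" W] by (simp add: coord_expansion)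
    also have "\<dots> \<le> (\<Sum>w\<in>W. k w * norm w)"
      using x by (intro sum_mono) (auto simp: Q_def intro!: mult_right_mono)
    finally show "norm x \<le> (\<Sum>w\<in>W. k w * norm w)" .
  qed
qed

definition irreducibles :: "'a set" where
  "irreducibles = {x \<in> Q \<inter> M. x \<noteq> 0 \<and> (\<forall>y\<in>Q \<inter> M. \<forall>z\<in>Q \<inter> M. x = y + z \<longrightarrow> y = 0 \<or> z = 0)}"

text \<open>
  Splitting terminates because the finite set of lattice points of \<open>Q \<inter> (x - Q)\<close> shrinks when \<open>x\<close>
  is replaced by a proper summand.
\<close>
lemma sum_irreducibles:
  assumes "x \<in> Q \<inter> M"
  shows "\<exists>hs. set hs \<subseteq> irreducibles \<and> sum_list hs = x"
proof -
  define D where "D = (\<lambda>x. {y \<in> Q \<inter> M. x - y \<in> Q})"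
  have fin: "finite (D x)" for x
    by (rule finite_subset[OF _ finite_box[of "\<lambda>w. coord w x"]])
      (auto simp: D_def Q_def coord_diff)
  have smaller: "card (D y) < card (D (y + z))" if "y \<in> Q \<inter> M" "z \<in> Q \<inter> M" "z \<noteq> 0" for y z
  proof (rule psubset_card_mono[OF fin], rule psubsetI)
    show "D y \<subseteq> D (y + z)"
    proof
      fix v assume "v \<in> D y"
      then show "v \<in> D (y + z)"
        unfolding D_def using that Q_add[of "y - v" z] by (simp add: algebra_simps)
    qed
    have "y + z \<in> D (y + z)"
      unfolding D_def using that lattice_add[OF lattice] by (auto simp: Q_add zero_in_Q)
    moreover have "y + z \<notin> D y" unfolding D_def using that Q_pointed[of z] by auto
    ultimately show "D y \<noteq> D (y + z)" by blast
  qed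
  show ?thesis using assms
  proof (induction "card (D x)" arbitrary: x rule: less_induct)
    case less
    show ?case
    proof (cases "x = 0 \<or> x \<in> irreducibles")
      case True
      then show ?thesis
        by (elim disjE) (auto intro: exI[of _ "[]"] exI[of _ "[x]"])
    next
      case False
      then obtain y z where yz: "y \<in> Q \<inter> M" "z \<in> Q \<inter> M" "x = y + z" "y \<noteq> 0" "z \<noteq> 0"
        using less.prems unfolding irreducibles_def by auto
      obtain hs where hs: "set hs \<subseteq> irreducibles" "sum_list hs = y"
        using less.hyps[of y] smaller[of y z] yz by blast
      obtain ks where ks: "set ks \<subseteq> irreducibles" "sum_list ks = z"
        using less.hyps[of z] smaller[of z y] yz by (auto simp: add.commute)
      show ?thesis by (intro exI[of _ "hs @ ks"]) (use hs ks yz in auto)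
    qed
  qed
qed

lemma Q_M_combination:
  assumes "H \<subseteq> Q \<inter> M"
  shows "(\<Sum>h\<in>H. of_nat (c h) *\<^sub>R h) \<in> Q \<inter> M"
proof -
  have "(\<Sum>h\<in>H. of_nat (c h) *\<^sub>R h) \<in> Q" using assms
    by (induction H rule: infinite_finite_induct) (auto simp: zero_in_Q intro!: Q_add Q_scale)
  then show ?thesis using assms by (auto intro!: lattice_sum lattice_scale_nat lattice)
qed

text \<open>
  In a pointed cone a nontrivial combination that equals an irreducible point consists of this point
  alone. The lemma yields both that every generating set contains the irreducible points and that
  these have order \<open>1\<close>. Vectors \<open>h = 0\<close> are excluded because a generating set may contain
  the origin, with an arbitrary coefficient.
\<close>
lemma irreducible_combination:
  assumes H: "H \<subseteq> Q \<inter> M" "finite H" and x: "x \<in> irreducibles"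
    and c: "x = (\<Sum>h\<in>H. of_nat (c h) *\<^sub>R h)" and g: "g \<in> H" "c g \<noteq> 0" "g \<noteq> 0"
  shows "x = g \<and> (\<forall>h\<in>H. h \<noteq> 0 \<longrightarrow> c h = (if h = g then 1 else 0))"
proof -
  define c' where "c' = c(g := c g - 1)"
  define y where "y = (\<Sum>h\<in>H. of_nat (c' h) *\<^sub>R h)"
  have y: "y \<in> Q \<inter> M" unfolding y_def by (rule Q_M_combination[OF H(1)])
  have "x = of_nat (c g) *\<^sub>R g + (\<Sum>h\<in>H - {g}. of_nat (c h) *\<^sub>R h)"
    using c H g by (simp add: sum.remove)
  moreover have "y = of_nat (c g - 1) *\<^sub>R g + (\<Sum>h\<in>H - {g}. of_nat (c h) *\<^sub>R h)"
    unfolding y_def c'_def using H g by (simp add: sum.remove)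
  ultimately have xy: "x = g + y" using g(2) by (simp add: of_nat_diff algebra_simps)
  then have y0: "y = 0" using x y H(1) g unfolding irreducibles_def by blast
  have "c' h = 0" if h: "h \<in> H" "h \<noteq> 0" for h
  proof -
    obtain w where w: "w \<in> W" "coord w h \<noteq> 0"
      using coord_inject[of h 0] h(2) by (auto simp: coord_zero)
    \<comment> \<open>no cancellation can occur: the terms of this sum are nonnegative\<close>
    have "coord w y = (\<Sum>h\<in>H. of_nat (c' h) * coord w h)"
      unfolding y_def by (simp add: coord_sum coord_scale)
    then have "(\<Sum>h\<in>H. of_nat (c' h) * coord w h) = 0" using y0 by (simp add: coord_zero)
    moreover have "\<And>h. h \<in> H \<Longrightarrow> 0 \<le> of_nat (c' h) * coord w h" using H(1) w unfolding Q_def by auto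
    ultimately have "of_nat (c' h) * coord w h = 0" using H(2) h(1) by (simp add: sum_nonneg_eq_0_iff)
    then show ?thesis using w by simp
  qed
  then have "c h = (if h = g then 1 else 0)" if "h \<in> H" "h \<noteq> 0" for h
    using that g(2) \<open>\<And>h. \<lbrakk>h \<in> H; h \<noteq> 0\<rbrakk> \<Longrightarrow> c' h = 0\<close>[OF that]
    unfolding c'_def by (cases "h = g") auto
  then show ?thesis using xy y0 by simp
qed

lemma irreducibles_subset_generators:
  assumes "generates_monoid H (Q \<inter> M)"
  shows "irreducibles \<subseteq> H"
proof
  fix x assume x: "x \<in> irreducibles"
  have fH: "finite H" and eq: "Q \<inter> M = {\<Sum>h\<in>H. of_nat (c h) *\<^sub>R h | c :: 'a \<Rightarrow> nat. True}"
    using assms unfolding generates_monoid_def by auto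
  have sub: "H \<subseteq> Q \<inter> M"
  proof
    fix h assume h: "h \<in> H"
    have "(\<Sum>g\<in>H. of_nat (if g = h then 1 else 0) *\<^sub>R g) = h"
      using h fH by (simp add: if_distrib[of of_nat] if_distrib[of "\<lambda>c. c *\<^sub>R _"] cong: if_cong)
    then show "h \<in> Q \<inter> M" unfolding eq by (intro CollectI exI[of _ "\<lambda>g. if g = h then 1 else 0"]) auto
  qed
  obtain c :: "'a \<Rightarrow> nat" where c: "x = (\<Sum>h\<in>H. of_nat (c h) *\<^sub>R h)"
    using x eq unfolding irreducibles_def by blast
  have "x \<noteq> 0" using x unfolding irreducibles_def by blast
  then obtain g where "g \<in> H" "of_nat (c g) *\<^sub>R g \<noteq> 0"
    using c by (metis (no_types, lifting) sum.neutral)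
  then have "x = g" using irreducible_combination[OF sub fH x c, of g] by auto
  then show "x \<in> H" using \<open>g \<in> H\<close> by simp
qed

text \<open>
  A point with a coordinate larger than \<open>1\<close> remains in the cone when the corresponding generator is
  subtracted, so it is reducible.
\<close>
lemma finite_irreducibles: "finite irreducibles"
proof (rule finite_subset[OF _ finite_box[of "\<lambda>_. 1"]], rule subsetI)
  fix x assume x: "x \<in> irreducibles"
  then have xQ: "x \<in> Q" "x \<in> M" unfolding irreducibles_def by auto
  have "coord w x \<le> 1" if w: "w \<in> W" for w
  proof (rule ccontr)
    assume "\<not> coord w x \<le> 1"
    then have "x - w \<in> Q" using xQ w unfolding Q_def by (auto simp: coord_diff coord_W)
    moreover have "x - w \<in> M" using lattice_diff[OF lattice] xQ W_in_M w by blast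
    moreover have "w \<in> Q \<inter> M" using w W_in_Q W_in_M by auto
    moreover have "w \<noteq> 0" using primitive[OF w] unfolding primitive_vector_def by auto
    moreover have "x = w + (x - w)" by simp
    ultimately have "x - w = 0" using x unfolding irreducibles_def by blast
    then have "coord w x = 1" using w by (simp add: coord_W)
    then show False using \<open>\<not> coord w x \<le> 1\<close> by simp
  qed
  then show "x \<in> {x \<in> Q. \<forall>w\<in>W. coord w x \<le> 1} \<inter> M" using xQ by auto
qed

lemma irreducibles_generate: "generates_monoid irreducibles (Q \<inter> M)"
  unfolding generates_monoid_def
proof (intro conjI finite_irreducibles subset_antisym subsetI)
  fix x assume "x \<in> Q \<inter> M"
  then obtain hs where hs: "set hs \<subseteq> irreducibles" "sum_list hs = x" using sum_irreducibles by blast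
  have "sum_list hs = (\<Sum>h\<in>irreducibles. of_nat (count_list hs h) *\<^sub>R h)" using hs(1)
  proof (induction hs)
    case (Cons g hs)
    have "(\<Sum>h\<in>irreducibles. of_nat (count_list (g # hs) h) *\<^sub>R h)
        = (\<Sum>h\<in>irreducibles. (if h = g then h else 0) + of_nat (count_list hs h) *\<^sub>R h)"
      by (intro sum.cong) (auto simp: algebra_simps)
    also have "\<dots> = g + sum_list hs"
      using Cons finite_irreducibles by (simp add: sum.distrib)
    finally show ?case by simp
  qed simp
  then show "x \<in> {\<Sum>h\<in>irreducibles. of_nat (c h) *\<^sub>R h | c :: 'a \<Rightarrow> nat. True}" using hs by auto
next
  fix x assume "x \<in> {\<Sum>h\<in>irreducibles. of_nat (c h) *\<^sub>R h | c :: 'a \<Rightarrow> nat. True}"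
  then show "x \<in> Q \<inter> M" using Q_M_combination[of irreducibles] unfolding irreducibles_def by blast
qed

lemma hilbert_basis_Q: "hilbert_basis M Q = irreducibles"
  unfolding hilbert_basis_def
proof (rule the_equality)
  show "generates_monoid irreducibles (Q \<inter> M) \<and>
      (\<forall>H'. H' \<subset> irreducibles \<longrightarrow> \<not> generates_monoid H' (Q \<inter> M))"
    using irreducibles_generate irreducibles_subset_generators by blast
  show "H = irreducibles" if "generates_monoid H (Q \<inter> M) \<and>
      (\<forall>H'. H' \<subset> H \<longrightarrow> \<not> generates_monoid H' (Q \<inter> M))" for H
    using that irreducibles_generate irreducibles_subset_generators by blast
qed

lemma cone_ord_irreducible:
  assumes x: "x \<in> irreducibles"
  shows "cone_ord M Q x = 1"
proof -
  let ?I = irreducibles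
  have sub: "?I \<subseteq> Q \<inter> M" and nz: "\<And>h. h \<in> ?I \<Longrightarrow> h \<noteq> 0" unfolding irreducibles_def by auto
  have "{\<Sum>b\<in>?I. l b | l :: 'a \<Rightarrow> nat. x = (\<Sum>b\<in>?I. of_nat (l b) *\<^sub>R b)} = {1}" (is "?S = _")
  proof
    show "?S \<subseteq> {1}"
    proof
      fix s assume "s \<in> ?S"
      then obtain l where l: "s = (\<Sum>b\<in>?I. l b)" "x = (\<Sum>b\<in>?I. of_nat (l b) *\<^sub>R b)" by blast
      obtain g where g: "g \<in> ?I" "of_nat (l g) *\<^sub>R g \<noteq> 0"
        using l(2) nz[OF x] by (metis (no_types, lifting) sum.neutral)
      have "\<forall>h\<in>?I. l h = (if h = g then 1 else 0)"
        using irreducible_combination[OF sub finite_irreducibles x l(2) g(1)] g(2) nz by auto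
      then have "s = (\<Sum>b\<in>?I. if b = g then 1 else 0)" unfolding l(1) by (intro sum.cong) auto
      then show "s \<in> {1}" using g(1) finite_irreducibles by simp
    qed
    have "x = (\<Sum>b\<in>?I. of_nat (if b = x then 1 else 0) *\<^sub>R b)"
      using x finite_irreducibles
      by (simp add: if_distrib[of of_nat] if_distrib[of "\<lambda>c. c *\<^sub>R _"] cong: if_cong)
    moreover have "1 = (\<Sum>b\<in>?I. if b = x then 1 else (0::nat))"
      using x finite_irreducibles by simp
    ultimately have "1 \<in> ?S"
      by (intro CollectI exI[of _ "\<lambda>b. if b = x then 1 else 0"]) auto
    then show "{1} \<subseteq> ?S" by blast
  qed
  then show ?thesis unfolding cone_ord_def hilbert_basis_Q by simp
qed

text \<open>
  A Hilbert basis element has order \<open>1\<close>, so its height exceeds \<open>\<Gamma>\<close> by at most \<open>1\<close>. The bound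
  \<open>L \<ge> \<Gamma> + 1\<close> enters the theorem through this estimate.
\<close>
lemma ht_irreducible_le:
  assumes x: "x \<in> irreducibles" "\<And>w. w \<in> W \<Longrightarrow> coord w x < 1"
  shows "ht x \<le> Gamma_cone M Q + 1"
proof -
  have xF: "x \<in> fundamental_set M Q \<inter> M"
    using x unfolding fundamental_set_Q irreducibles_def by auto
  have "finite (fundamental_set M Q \<inter> M)"
    by (rule finite_subset[OF _ finite_box[of "\<lambda>_. 1"]]) (force simp: fundamental_set_Q)
  then have "finite {cone_ht M Q u - real (cone_ord M Q u) | u. u \<in> fundamental_set M Q \<inter> M}"
    by (rule finite_image_set[of "\<lambda>u. u \<in> fundamental_set M Q \<inter> M", simplified Collect_mem_eq])
  then have "cone_ht M Q x - real (cone_ord M Q x) \<le> Gamma_cone M Q"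
    unfolding Gamma_cone_def using xF by (intro Max_ge) auto
  moreover have "x \<in> Q" using x unfolding irreducibles_def by auto
  ultimately show ?thesis using cone_ord_irreducible[OF x(1)] cone_ht_Q by simp
qed

end

section \<open>Splitting a lattice point of a simplicial cone\<close>

text \<open>
  Partial sums with steps of at most \<open>d\<close> cannot jump over the window \<open>[b - d, b]\<close>.
\<close>
lemma partial_sum_in_window:
  fixes f :: "'b \<Rightarrow> real"
  assumes "\<And>x. x \<in> set xs \<Longrightarrow> f x \<le> d" "c \<le> b" "b - d \<le> c + sum_list (map f xs)"
  shows "\<exists>m. b - d \<le> c + sum_list (map f (take m xs)) \<and> c + sum_list (map f (take m xs)) \<le> b"
  using assms
proof (induction xs arbitrary: c)
  case Nil
  then show ?case by auto
next
  case (Cons y ys)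
  show ?case
  proof (cases "b - d \<le> c")
    case True
    then show ?thesis using Cons.prems(2) by (intro exI[of _ 0]) auto
  next
    case False
    then have "c + f y \<le> b" using Cons.prems(1)[of y] by simp
    then obtain m where "b - d \<le> (c + f y) + sum_list (map f (take m ys))"
      "(c + f y) + sum_list (map f (take m ys)) \<le> b"
      using Cons.IH[of "c + f y"] Cons.prems by (auto simp: add.assoc)
    then show ?thesis by (intro exI[of _ "Suc m"]) (auto simp: add.assoc)
  qed
qed

context simplicial_cone
begin

text \<open>
  For a vertex cone of a simplex, \<open>l w\<close> is the multiplicity of \<open>w\<close> in its edge vector. Then \<open>wt l\<close> is
  the sum of the barycentric coordinates at the other vertices.
\<close>
definition wt :: "('a \<Rightarrow> real) \<Rightarrow> 'a \<Rightarrow> real" where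
  "wt l x = (\<Sum>w\<in>W. coord w x / l w)"

lemma wt_add: "wt l (x + y) = wt l x + wt l y"
  unfolding wt_def by (simp add: coord_add add_divide_distrib sum.distrib)

lemma wt_diff: "wt l (x - y) = wt l x - wt l y"
  unfolding wt_def by (simp add: coord_diff diff_divide_distrib sum_subtractf)

lemma wt_zero: "wt l 0 = 0"
  unfolding wt_def by (simp add: coord_zero)

lemma wt_scale: "wt l (c *\<^sub>R x) = c * wt l x"
  unfolding wt_def by (simp add: coord_scale sum_distrib_left)

lemma wt_sum: "wt l (sum f I) = (\<Sum>i\<in>I. wt l (f i))"
  by (induction I rule: infinite_finite_induct) (auto simp: wt_zero wt_add)

lemma wt_sum_list: "wt l (sum_list xs) = sum_list (map (wt l) xs)"
  by (induction xs) (auto simp: wt_zero wt_add)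

lemma wt_W: "w \<in> W \<Longrightarrow> wt l w = 1 / l w"
  unfolding wt_def by (simp add: coord_W if_distrib[of "\<lambda>c. c / _"] finite_W cong: if_cong)

lemma wt_le_ht:
  assumes "x \<in> Q" "k > 0" "\<And>w. w \<in> W \<Longrightarrow> k \<le> l w"
  shows "wt l x \<le> ht x / k"
  unfolding wt_def ht_def sum_divide_distrib
  using assms by (intro sum_mono frac_le) (auto simp: Q_def)

lemma Q_M_sum_list: "set xs \<subseteq> Q \<inter> M \<Longrightarrow> sum_list xs \<in> Q \<inter> M"
  by (induction xs) (auto simp: zero_in_Q lattice_zero[OF lattice] intro!: Q_add lattice_add[OF lattice])

lemma multiples_as_list:
  assumes "V \<subseteq> W"
  shows "\<exists>ws. set ws \<subseteq> W \<and> sum_list ws = (\<Sum>w\<in>V. of_nat (c w) *\<^sub>R w)"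
  using finite_subset[OF assms finite_W] assms
proof (induction V rule: finite_induct)
  case empty
  then show ?case by (intro exI[of _ "[]"]) auto
next
  case (insert v V)
  then obtain ws where "set ws \<subseteq> W" "sum_list ws = (\<Sum>w\<in>V. of_nat (c w) *\<^sub>R w)" by auto
  moreover have "sum_list (replicate n v) = of_nat n *\<^sub>R v" for n
    by (induction n) (auto simp: algebra_simps)
  moreover have "set (replicate (c v) v) \<subseteq> W" using insert.prems by auto
  ultimately show ?case using insert.hyps
    by (intro exI[of _ "replicate (c v) v @ ws"]) auto
qed

text \<open>
  Every Hilbert basis element in \<open>s\<close> has weight at most \<open>1\<close>. Either one of them weighs at least \<open>1/2\<close>, or
  all steps are at most \<open>1/2\<close> and some partial sum of a heavy \<open>s\<close> lands in \<open>[1/2, 1]\<close>.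
\<close>
lemma split_fundamental_point:
  assumes k: "k > 0" "Gamma_cone M Q + 1 \<le> k" and l: "\<And>w. w \<in> W \<Longrightarrow> k \<le> l w"
    and s: "s \<in> Q \<inter> M" "\<And>w. w \<in> W \<Longrightarrow> coord w s < 1"
  shows "\<exists>x. x \<in> Q \<inter> M \<and> s - x \<in> Q \<inter> M \<and> wt l x \<le> 1 \<and> (x = s \<or> 1 / 2 \<le> wt l x)"
proof -
  obtain hs where hs: "set hs \<subseteq> irreducibles" "sum_list hs = s"
    using sum_irreducibles[OF s(1)] by blast
  have hsQ: "set hs \<subseteq> Q \<inter> M" using hs(1) unfolding irreducibles_def by blast
  have rest: "s - h \<in> Q \<inter> M" if h: "h \<in> set hs" for h
  proof -
    obtain ys zs where "hs = ys @ h # zs" using split_list[OF h] by blast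
    then have "s - h = sum_list (ys @ zs)" "set (ys @ zs) \<subseteq> Q \<inter> M" using hs(2) hsQ by auto
    then show ?thesis using Q_M_sum_list by metis
  qed
  have wt_h: "wt l h \<le> 1" if h: "h \<in> set hs" for h
  proof -
    have "coord w h < 1" if "w \<in> W" for w
      using rest[OF h] s(2)[OF that] that unfolding Q_def by (auto simp: coord_diff)
    then have "ht h \<le> k" using ht_irreducible_le[of h] h hs(1) k(2) by force
    have "wt l h \<le> ht h / k" using wt_le_ht[of h k l] h hsQ k l by blast
    also have "\<dots> \<le> 1" using \<open>ht h \<le> k\<close> k(1) by simp
    finally show ?thesis .
  qed
  consider "wt l s \<le> 1" | h where "h \<in> set hs" "1 / 2 \<le> wt l h"
    | "1 < wt l s" "\<And>h. h \<in> set hs \<Longrightarrow> wt l h \<le> 1 / 2" by fastforce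
  then show ?thesis
  proof cases
    case 1
    then show ?thesis using s lattice_zero[OF lattice] zero_in_Q by (intro exI[of _ s]) auto
  next
    case 2
    then show ?thesis using rest wt_h hsQ by blast
  next
    case 3
    obtain m where m: "1 / 2 \<le> wt l (sum_list (take m hs))" "wt l (sum_list (take m hs)) \<le> 1"
      using partial_sum_in_window[of hs "wt l" "1 / 2" 0 1] 3 hs(2) by (auto simp: wt_sum_list)
    have "sum_list (take m hs) + sum_list (drop m hs) = s"
      by (metis append_take_drop_id hs(2) sum_list_append)
    then have "s - sum_list (take m hs) = sum_list (drop m hs)" by (metis add_diff_cancel_left')
    moreover have "set (take m hs) \<subseteq> Q \<inter> M" "set (drop m hs) \<subseteq> Q \<inter> M"
      using hsQ by (meson order_trans set_take_subset set_drop_subset)+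
    ultimately show ?thesis using m Q_M_sum_list
      by (intro exI[of _ "sum_list (take m hs)"]) simp
  qed
qed

text \<open>
  The part \<open>x0\<close> of the fractional point \<open>s\<close> supplies a start below the upper end of the window, and the
  generators in the integral point \<open>y\<close> are the steps of size at most \<open>a\<close>. The constants fit together:
  if \<open>x0\<close> is not all of \<open>s\<close>, then \<open>wt x0 + wt y \<ge> 1/2 + (wt z - 3/2) \<ge> 1 - a\<close>.
\<close>
lemma split_cone_point:
  assumes k: "k > 0" "Gamma_cone M Q + 1 \<le> k" "2 / 3 * real (card W) \<le> k"
    and l: "\<And>w. w \<in> W \<Longrightarrow> k \<le> l w"
    and z: "z \<in> Q \<inter> M" "2 - a \<le> wt l z" and a: "1 / k \<le> a"
  shows "\<exists>x. x \<in> Q \<inter> M \<and> z - x \<in> Q \<inter> M \<and> 1 - a \<le> wt l x \<and> wt l x \<le> 1"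
proof -
  define y where "y = (\<Sum>w\<in>W. of_nat (nat \<lfloor>coord w z\<rfloor>) *\<^sub>R w)"
  define s where "s = z - y"
  have coord_s: "coord w s = frac (coord w z)" if "w \<in> W" for w
    using that z(1) unfolding s_def y_def Q_def
    by (auto simp: coord_diff coord_combination frac_def)
  obtain ws where ws: "set ws \<subseteq> W" "sum_list ws = y"
    using multiples_as_list[OF subset_refl, of "\<lambda>w. nat \<lfloor>coord w z\<rfloor>"] unfolding y_def by blast
  have wsQ: "set ws \<subseteq> Q \<inter> M" using ws(1) W_in_Q W_in_M by blast
  have "y \<in> M" using Q_M_sum_list[OF wsQ] ws(2) by blast
  then have s: "s \<in> Q \<inter> M" "\<And>w. w \<in> W \<Longrightarrow> coord w s < 1"
    using z(1) lattice_diff[OF lattice, of z y] by (auto simp: Q_def coord_s frac_lt_1 s_def[symmetric])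
  have "ht s \<le> real (card W)"
    unfolding ht_def using sum_mono[of W "\<lambda>w. coord w s" "\<lambda>w. 1"] s(2) by (simp add: less_imp_le)
  then have "ht s / k \<le> 3 / 2" using k(1,3) by (simp add: pos_divide_le_eq)
  moreover have "wt l s \<le> ht s / k" using wt_le_ht[of s k l] s k l by blast
  ultimately have wt_s: "wt l s \<le> 3 / 2" by linarith
  obtain x0 where x0: "x0 \<in> Q \<inter> M" "s - x0 \<in> Q \<inter> M" "wt l x0 \<le> 1" "x0 = s \<or> 1 / 2 \<le> wt l x0"
    using split_fundamental_point[of k l s] k(1,2) l s by blast
  have "wt l z = wt l s + wt l y" unfolding s_def by (simp add: wt_diff)
  then have enough: "1 - a \<le> wt l x0 + wt l y" using x0(4) wt_s z(2) by auto
  have step: "wt l w \<le> a" if "w \<in> set ws" for w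
  proof -
    have "w \<in> W" using that ws(1) by blast
    then have "wt l w \<le> 1 / k" using l[of w] k(1) by (simp add: wt_W frac_le)
    then show ?thesis using a by simp
  qed
  obtain m where m: "1 - a \<le> wt l x0 + wt l (sum_list (take m ws))"
      "wt l x0 + wt l (sum_list (take m ws)) \<le> 1"
    using partial_sum_in_window[of ws "wt l" a "wt l x0" 1] step x0(3) enough ws(2)
    by (auto simp: wt_sum_list)
  have take_drop: "set (take m ws) \<subseteq> Q \<inter> M" "set (drop m ws) \<subseteq> Q \<inter> M"
    using wsQ by (meson order_trans set_take_subset set_drop_subset)+
  have "y = sum_list (take m ws) + sum_list (drop m ws)"
    by (metis append_take_drop_id ws(2) sum_list_append)
  then have rest: "z - (x0 + sum_list (take m ws)) = (s - x0) + sum_list (drop m ws)"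
    unfolding s_def by (simp add: algebra_simps)
  have "x0 + sum_list (take m ws) \<in> Q \<inter> M" "z - (x0 + sum_list (take m ws)) \<in> Q \<inter> M"
    unfolding rest using x0 Q_M_sum_list[OF take_drop(1)] Q_M_sum_list[OF take_drop(2)]
    by (simp_all add: Q_add lattice_add[OF lattice])
  then show ?thesis using m by (intro exI[of _ "x0 + sum_list (take m ws)"]) (simp add: wt_add)
qed

end

section \<open>Lattice simplices\<close>

locale lattice_simplex_vertices =
  fixes M V :: "'a::euclidean_space set"
  assumes lattice: "is_lattice M"
    and V_in_M: "V \<subseteq> M"
    and V_indep: "\<not> affine_dependent V"
    and card_V: "card V = DIM('a) + 1"
begin

text \<open>
  For \<open>k > 0\<close> this is the dilated simplex; barycentric coordinates of sum \<open>k\<close> avoid the division by \<open>k\<close>.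
\<close>
definition dilate :: "real \<Rightarrow> 'a set" where
  "dilate k = {\<Sum>v\<in>V. a v *\<^sub>R v | a. (\<forall>v\<in>V. 0 \<le> a v) \<and> sum a V = k}"

lemma finite_V: "finite V"
  using V_indep affine_independent_iff_card by blast

lemma dilate_image:
  assumes "k > 0"
  shows "(\<lambda>x. k *\<^sub>R x) ` (convex hull V) = dilate k"
proof (intro subset_antisym subsetI)
  fix x assume "x \<in> (\<lambda>x. k *\<^sub>R x) ` (convex hull V)"
  then obtain a where "\<forall>v\<in>V. 0 \<le> a v" "sum a V = 1" "x = k *\<^sub>R (\<Sum>v\<in>V. a v *\<^sub>R v)"
    unfolding convex_hull_finite[OF finite_V] by auto
  then show "x \<in> dilate k" unfolding dilate_def using assms
    by (intro CollectI exI[of _ "\<lambda>v. k * a v"]) (auto simp: scaleR_sum_right sum_distrib_left[symmetric])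
next
  fix x assume "x \<in> dilate k"
  then obtain a where a: "\<forall>v\<in>V. 0 \<le> a v" "sum a V = k" "x = (\<Sum>v\<in>V. a v *\<^sub>R v)"
    unfolding dilate_def by auto
  have "(\<Sum>v\<in>V. (a v / k) *\<^sub>R v) \<in> convex hull V"
    unfolding convex_hull_finite[OF finite_V] using a assms
    by (intro CollectI exI[of _ "\<lambda>v. a v / k"]) (auto simp: sum_divide_distrib[symmetric])
  moreover have "x = k *\<^sub>R (\<Sum>v\<in>V. (a v / k) *\<^sub>R v)"
    using a assms by (simp add: scaleR_sum_right)
  ultimately show "x \<in> (\<lambda>x. k *\<^sub>R x) ` (convex hull V)" by blast
qed

lemma dilate_one: "convex hull V = dilate 1"
  using dilate_image[of 1] by simp

lemma dilate_add:
  assumes "x \<in> dilate k" "y \<in> dilate m"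
  shows "x + y \<in> dilate (k + m)"
proof -
  obtain a b where "\<forall>v\<in>V. 0 \<le> a v" "sum a V = k" "x = (\<Sum>v\<in>V. a v *\<^sub>R v)"
    "\<forall>v\<in>V. 0 \<le> b v" "sum b V = m" "y = (\<Sum>v\<in>V. b v *\<^sub>R v)"
    using assms unfolding dilate_def by auto
  then show ?thesis unfolding dilate_def
    by (intro CollectI exI[of _ "\<lambda>v. a v + b v"]) (auto simp: sum.distrib scaleR_add_left)
qed

lemma subtract_vertex:
  assumes a: "\<forall>v\<in>V. 0 \<le> a v" "sum a V = k" and v: "v \<in> V" "1 \<le> a v"
  shows "v \<in> dilate 1" "(\<Sum>v\<in>V. a v *\<^sub>R v) - v \<in> dilate (k - 1)"
proof -
  show "v \<in> dilate 1" using v(1) dilate_one by (metis hull_inc)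
  let ?b = "a(v := a v - 1)"
  have "(\<Sum>v\<in>V. a v *\<^sub>R v) - v = (\<Sum>v\<in>V. ?b v *\<^sub>R v)" "sum ?b V = k - 1"
    using v finite_V a(2) by (auto simp: sum.remove[of V v] algebra_simps)
  then show "(\<Sum>v\<in>V. a v *\<^sub>R v) - v \<in> dilate (k - 1)"
    unfolding dilate_def using a v by (intro CollectI exI[of _ ?b]) auto
qed

lemma closed_segment_edge:
  assumes "u \<in> V" "v \<in> V"
  shows "closed_segment u v edge_of convex hull V \<longleftrightarrow> u \<noteq> v"
proof -
  have "closed_segment u v face_of convex hull V"
    unfolding face_of_convex_hull_affine_independent[OF V_indep] segment_convex_hull
    using assms by (intro exI[of _ "{u, v}"]) auto
  moreover have "aff_dim (closed_segment u v) = (if u = v then 0 else 1)"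
    unfolding segment_convex_hull aff_dim_convex_hull by (rule aff_dim_2)
  ultimately show ?thesis unfolding edge_of_def by simp
qed

lemma vertices_hull: "vertices (convex hull V) = V"
  unfolding vertices_def using extreme_point_of_convex_hull_affine_independent[OF V_indep] by blast

lemma min_lattice_length_le:
  assumes "u \<in> V" "v \<in> V" "u \<noteq> v"
  shows "min_lattice_length M (convex hull V) \<le> lattice_length M (closed_segment u v)"
proof -
  let ?P = "convex hull V"
  have "finite {e. e face_of ?P}"
    by (rule finite_polytope_faces) (use finite_V in \<open>auto simp: polytope_def\<close>)
  then have "finite {e. e edge_of ?P}"
    by (rule rev_finite_subset) (auto simp: edge_of_def)
  then have "finite {lattice_length M e | e. e edge_of ?P}" by (rule finite_image_set)
  then show ?thesis unfolding min_lattice_length_def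
    using closed_segment_edge assms by (intro Min_le) auto
qed

lemma Gamma_cone_le:
  assumes "u \<in> V"
  shows "Gamma_cone M (vertex_cone (convex hull V) u) \<le> Gamma_polytope M (convex hull V)"
  unfolding Gamma_polytope_def vertices_hull using assms finite_V
  by (intro Max_ge) auto

text \<open>
  The largest coordinate is at least the average.
\<close>
lemma max_barycentric_coordinate:
  fixes a :: "'a \<Rightarrow> real"
  obtains v where "v \<in> V" "sum a V \<le> (real DIM('a) + 1) * a v"
proof -
  have "V \<noteq> {}" using card_V by auto
  then have "Max (a ` V) \<in> a ` V" using finite_V by (intro Max_in) auto
  then obtain v where "v \<in> V" "a v = Max (a ` V)" by auto
  then have v: "v \<in> V" "\<And>u. u \<in> V \<Longrightarrow> a u \<le> a v" using finite_V by auto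
  have "sum a V \<le> real (card V) * a v" using v(2) by (rule sum_bounded_above)
  then show thesis using that v card_V by (auto simp: add.commute)
qed

text \<open>
  The primitive edge vectors at a vertex span the space and there are at most \<open>n\<close> of them, so they form
  a basis. The map \<open>w \<mapsto> v0 + l w\<close> sends each of them to the vertex at the other end of its edge.
\<close>
lemma vertex_cone_simplicial:
  assumes v0: "v0 \<in> V"
  obtains W l where "simplicial_cone M W" "card W = DIM('a)"
    "vertex_cone (convex hull V) v0 = simplicial_cone.Q W"
    "\<And>w. w \<in> W \<Longrightarrow> min_lattice_length M (convex hull V) \<le> l w"
    "bij_betw (\<lambda>w. v0 + real (l w) *\<^sub>R w) W (V - {v0})"
    "\<And>w. w \<in> W \<Longrightarrow> 0 < l w"
proof -
  define E where "E = V - {v0}"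
  have cardE: "card E = DIM('a)" unfolding E_def using card_V v0 finite_V by simp
  have fE: "finite E" unfolding E_def using finite_V by simp
  have "\<exists>w l. primitive_vector M w \<and> v - v0 = real l *\<^sub>R w \<and> 0 < l \<and>
      lattice_length M (closed_segment v0 v) \<le> l" if "v \<in> E" for v
    using lattice_segment_primitive[OF lattice, of v0 v] that v0 V_in_M unfolding E_def by blast
  then obtain g m where gm: "\<And>v. v \<in> E \<Longrightarrow> primitive_vector M (g v)"
    "\<And>v. v \<in> E \<Longrightarrow> v - v0 = real (m v) *\<^sub>R g v" "\<And>v. v \<in> E \<Longrightarrow> 0 < m v"
    "\<And>v. v \<in> E \<Longrightarrow> lattice_length M (closed_segment v0 v) \<le> m v" by metis
  define W where "W = g ` E"
  have fW: "finite W" unfolding W_def using fE by simp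
  have D_indep: "independent ((\<lambda>x. - v0 + x) ` E)"
    using V_indep affine_dependent_iff_dependent2[OF v0] unfolding E_def by simp
  have "card ((\<lambda>x. - v0 + x) ` E) = DIM('a)" using cardE by (simp add: card_image)
  then have "UNIV \<subseteq> span ((\<lambda>x. - v0 + x) ` E)"
    using D_indep by (intro card_ge_dim_independent) auto
  moreover have "(\<lambda>x. - v0 + x) ` E \<subseteq> span W"
  proof
    fix y assume "y \<in> (\<lambda>x. - v0 + x) ` E"
    then obtain v where "v \<in> E" "y = real (m v) *\<^sub>R g v" using gm(2) by auto
    then show "y \<in> span W" using span_scale[OF span_base, of "g v" W "real (m v)"] by (simp add: W_def)
  qed
  then have "span ((\<lambda>x. - v0 + x) ` E) \<subseteq> span W" by (intro span_minimal) auto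
  ultimately have spanW: "span W = UNIV" by blast
  have leW: "card W \<le> DIM('a)" unfolding W_def using card_image_le[OF fE, of g] cardE by simp
  have indepW: "independent W"
    using card_le_dim_spanning[of W UNIV] spanW fW leW by simp
  have cardW: "card W = DIM('a)"
    using dim_eq_card[of W UNIV] spanW indepW by simp
  have inj: "inj_on g E" using fE cardE cardW unfolding W_def by (simp add: eq_card_imp_inj_on)
  interpret C: simplicial_cone M W
    by unfold_locales (use lattice indepW spanW gm(1) in \<open>auto simp: W_def\<close>)
  have "vertex_cone (convex hull V) v0 = convex_cone hull ((\<lambda>v. v - v0) ` E)"
  proof -
    have "{v - v0 | v. v \<in> V \<and> closed_segment v0 v edge_of convex hull V} = (\<lambda>v. v - v0) ` E"
      unfolding E_def using closed_segment_edge[OF v0] by auto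
    then show ?thesis unfolding vertex_cone_def vertices_hull by simp
  qed
  also have "\<dots> = convex_cone hull W"
  proof (intro subset_antisym hull_minimal convex_cone_convex_cone_hull subsetI)
    fix x assume "x \<in> (\<lambda>v. v - v0) ` E"
    then obtain v where v: "v \<in> E" "x = real (m v) *\<^sub>R g v" using gm(2) by auto
    then show "x \<in> convex_cone hull W"
      using convex_cone_hull_mul[OF hull_inc, of "g v" W "real (m v)"] by (simp add: W_def)
  next
    fix x assume "x \<in> W"
    then obtain v where v: "v \<in> E" "x = g v" unfolding W_def by auto
    then have "x = (1 / real (m v)) *\<^sub>R (v - v0)" using gm(2,3)[of v] by simp
    moreover have "v - v0 \<in> convex_cone hull ((\<lambda>v. v - v0) ` E)" using v by (intro hull_inc) auto
    ultimately show "x \<in> convex_cone hull ((\<lambda>v. v - v0) ` E)" by (simp add: convex_cone_hull_mul)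
  qed
  finally have cone: "vertex_cone (convex hull V) v0 = C.Q" using C.convex_cone_hull_W by simp
  define h where "h = inv_into E g"
  have h: "h (g v) = v" if "v \<in> E" for v unfolding h_def using inj that by simp
  define l where "l = (\<lambda>w. m (h w))"
  show thesis
  proof (rule that[of W l])
    show "simplicial_cone M W" by unfold_locales
    show "card W = DIM('a)" by (rule cardW)
    show "vertex_cone (convex hull V) v0 = C.Q" by (rule cone)
    show "min_lattice_length M (convex hull V) \<le> l w" "0 < l w" if w: "w \<in> W" for w
    proof -
      obtain v where v: "v \<in> E" "w = g v" using w unfolding W_def by auto
      then show "0 < l w" unfolding l_def using gm(3) h by simp
      have "min_lattice_length M (convex hull V) \<le> lattice_length M (closed_segment v0 v)"
        using v v0 unfolding E_def by (intro min_lattice_length_le) auto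
      then show "min_lattice_length M (convex hull V) \<le> l w"
        unfolding l_def using gm(4) h v by force
    qed
    have "(\<lambda>w. v0 + real (l w) *\<^sub>R w) (g v) = v" if "v \<in> E" for v
      using gm(2)[OF that, symmetric] h[OF that] unfolding l_def by simp
    then show "bij_betw (\<lambda>w. v0 + real (l w) *\<^sub>R w) W (V - {v0})"
      unfolding W_def E_def[symmetric] by (intro bij_betwI[of _ _ _ g]) auto
  qed
qed

text \<open>
  The corner is placed at a vertex with largest coordinate, which makes the window as wide as possible.
\<close>
lemma split_dilate_point:
  assumes dim: "DIM('a) \<ge> 3"
    and len: "real (min_lattice_length M (convex hull V)) \<ge> 2 / 3 * real DIM('a)"
      "real (min_lattice_length M (convex hull V)) \<ge> Gamma_polytope M (convex hull V) + 1"
    and a: "\<forall>v\<in>V. 0 \<le> a v" "sum a V = real k" "2 \<le> k" and u: "(\<Sum>v\<in>V. a v *\<^sub>R v) \<in> M"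
  shows "\<exists>p \<in> dilate 1 \<inter> M. (\<Sum>v\<in>V. a v *\<^sub>R v) - p \<in> dilate (real k - 1)"
proof -
  let ?u = "\<Sum>v\<in>V. a v *\<^sub>R v"
  define L where "L = real (min_lattice_length M (convex hull V))"
  obtain v0 where v0: "v0 \<in> V" "sum a V \<le> (real DIM('a) + 1) * a v0"
    by (rule max_barycentric_coordinate)
  obtain W l where cone: "simplicial_cone M W" and cardW: "card W = DIM('a)"
    and Q: "vertex_cone (convex hull V) v0 = simplicial_cone.Q W"
    and l: "\<And>w. w \<in> W \<Longrightarrow> min_lattice_length M (convex hull V) \<le> l w"
    and bij: "bij_betw (\<lambda>w. v0 + real (l w) *\<^sub>R w) W (V - {v0})"
    and lpos: "\<And>w. w \<in> W \<Longrightarrow> 0 < l w"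
    using vertex_cone_simplicial[OF v0(1)] by blast
  interpret C: simplicial_cone M W by (rule cone)
  define wt where "wt = C.wt (\<lambda>w. real (l w))"
  define f where "f = (\<lambda>w. v0 + real (l w) *\<^sub>R w)"
  have L: "L > 0" "Gamma_cone M C.Q + 1 \<le> L" "2 / 3 * real (card W) \<le> L"
    using len dim Gamma_cone_le[OF v0(1)] unfolding L_def Q cardW by linarith+
  have f_bij: "bij_betw f W (V - {v0})" using bij unfolding f_def .
  have sum_V: "sum b V = b v0 + (\<Sum>w\<in>W. b (f w))" for b :: "'a \<Rightarrow> 'b::ab_group_add"
    using v0(1) finite_V sum.reindex_bij_betw[OF f_bij, of b] by (simp add: sum.remove)
  \<comment> \<open>the weight of \<open>x\<close> is what the coordinate at \<open>v0\<close> loses\<close>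
  have in_dilate: "m *\<^sub>R v0 + x \<in> dilate m" if x: "x \<in> C.Q" "wt x \<le> m" for m x
  proof -
    define h where "h = inv_into W f"
    have h: "h (f w) = w" if "w \<in> W" for w
      unfolding h_def using inv_into_f_f[OF bij_betw_imp_inj_on[OF f_bij] that] .
    define b where "b = (\<lambda>v. if v = v0 then m - wt x else C.coord (h v) x / real (l (h v)))"
    have bf: "b (f w) = C.coord w x / real (l w)" if "w \<in> W" for w
    proof -
      have "f w \<noteq> v0" using f_bij that unfolding bij_betw_def by auto
      then show ?thesis unfolding b_def using h that by simp
    qed
    have "0 \<le> b v" if v: "v \<in> V" for v
    proof (cases "v = v0")
      case False
      then obtain w where "w \<in> W" "v = f w"
        using f_bij v unfolding bij_betw_def by blast
      then show ?thesis using bf x(1) unfolding C.Q_def by simp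
    qed (use x in \<open>simp add: b_def\<close>)
    moreover have sum_b: "(\<Sum>w\<in>W. b (f w)) = wt x" unfolding wt_def C.wt_def using bf by simp
    then have "sum b V = m" unfolding sum_V by (simp add: b_def)
    moreover have "(\<Sum>v\<in>V. b v *\<^sub>R v) = m *\<^sub>R v0 + x"
    proof -
      have "(\<Sum>w\<in>W. b (f w) *\<^sub>R f w) = (\<Sum>w\<in>W. b (f w) *\<^sub>R v0 + C.coord w x *\<^sub>R w)"
      proof (rule sum.cong)
        fix w assume w: "w \<in> W"
        have "b (f w) *\<^sub>R f w = b (f w) *\<^sub>R v0 + (b (f w) * real (l w)) *\<^sub>R w"
          unfolding f_def by (simp add: algebra_simps)
        also have "b (f w) * real (l w) = C.coord w x" using bf[OF w] lpos[OF w] by simp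
        finally show "b (f w) *\<^sub>R f w = b (f w) *\<^sub>R v0 + C.coord w x *\<^sub>R w" .
      qed simp
      also have "\<dots> = wt x *\<^sub>R v0 + x"
        by (simp add: sum.distrib scaleR_sum_left[symmetric] sum_b C.coord_expansion)
      finally show ?thesis unfolding sum_V by (simp add: b_def algebra_simps)
    qed
    ultimately show ?thesis unfolding dilate_def by (intro CollectI exI[of _ b]) auto
  qed
  define z where "z = ?u - real k *\<^sub>R v0"
  have z_eq: "z = (\<Sum>w\<in>W. a (f w) *\<^sub>R (real (l w) *\<^sub>R w))"
  proof -
    have "real k = a v0 + (\<Sum>w\<in>W. a (f w))" using a(2) sum_V[of a] by simp
    then have "real k *\<^sub>R v0 = a v0 *\<^sub>R v0 + (\<Sum>w\<in>W. a (f w) *\<^sub>R v0)"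
      by (simp add: scaleR_add_left scaleR_sum_left)
    then have "z = (\<Sum>w\<in>W. a (f w) *\<^sub>R f w - a (f w) *\<^sub>R v0)"
      unfolding z_def sum_V by (simp add: sum_subtractf)
    also have "\<dots> = (\<Sum>w\<in>W. a (f w) *\<^sub>R (real (l w) *\<^sub>R w))"
      by (intro sum.cong) (auto simp: f_def algebra_simps)
    finally show ?thesis .
  qed
  have wt_z: "wt z = real k - a v0"
  proof -
    have "wt z = (\<Sum>w\<in>W. a (f w))"
      unfolding z_eq wt_def C.wt_sum using lpos by (intro sum.cong) (auto simp: C.wt_scale C.wt_W)
    then show ?thesis using a(2) sum_V[of a] by simp
  qed
  have "C.coord w z = a (f w) * real (l w)" if "w \<in> W" for w
    using that unfolding z_eq scaleR_scaleR by (rule C.coord_combination)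
  moreover have "f w \<in> V" if "w \<in> W" for w using f_bij that unfolding bij_betw_def by blast
  ultimately have zQ: "z \<in> C.Q" unfolding C.Q_def using a(1) by simp
  have "real k *\<^sub>R v0 \<in> M" "v0 \<in> M" using lattice_scale_nat[OF lattice] V_in_M v0(1) by auto
  then have zM: "z \<in> M" unfolding z_def using lattice_diff[OF lattice u] by simp
  have "1 / L \<le> a v0"
  proof -
    define n where "n = real DIM('a)"
    have n: "n \<ge> 3" "L \<ge> 2 / 3 * n" using dim L(3) cardW unfolding n_def by auto
    have "2 / (n + 1) \<le> a v0"
      using v0(2) a(2,3) n(1) unfolding n_def[symmetric] by (simp add: pos_divide_le_eq mult.commute)
    moreover have "1 / L \<le> 1 / (2 / 3 * n)" using n by (intro divide_left_mono) auto
    \<comment> \<open>equivalent to \<open>n \<ge> 3\<close>, so this is where dimension two needs a separate argument\<close>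
    moreover have "1 / (2 / 3 * n) \<le> 2 / (n + 1)" using n by (simp add: field_simps)
    ultimately show ?thesis by linarith
  qed
  moreover have "2 - a v0 \<le> wt z" using wt_z a(3) by simp
  ultimately obtain x where x: "x \<in> C.Q \<inter> M" "z - x \<in> C.Q \<inter> M" "1 - a v0 \<le> wt x" "wt x \<le> 1"
    using C.split_cone_point[of L "\<lambda>w. real (l w)" z "a v0"] L l zQ zM unfolding wt_def L_def by auto
  show ?thesis
  proof (intro bexI[of _ "v0 + x"] IntI)
    show "v0 + x \<in> dilate 1" using in_dilate[of x 1] x by simp
    show "v0 + x \<in> M" using x \<open>v0 \<in> M\<close> by (auto intro: lattice_add[OF lattice])
    have "wt (z - x) \<le> real k - 1" unfolding wt_def C.wt_diff using wt_z x(3) unfolding wt_def by simp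
    then have "(real k - 1) *\<^sub>R v0 + (z - x) \<in> dilate (real k - 1)" using in_dilate x(2) by blast
    moreover have "(real k - 1) *\<^sub>R v0 + (z - x) = ?u - (v0 + x)"
      unfolding z_def by (simp add: algebra_simps)
    ultimately show "?u - (v0 + x) \<in> dilate (real k - 1)" by simp
  qed
qed

end

section \<open>Lattice triangles\<close>

text \<open>
  The barycentric coordinates of \<open>q = x + y + z - u\<close> are \<open>1 - a\<close>, \<open>1 - b\<close>, \<open>1 - c\<close>. Subtracting from \<open>u\<close> the
  multiple \<open>t = a / (1 - a)\<close> of \<open>q\<close> removes \<open>x\<close>, and the other coordinates remain nonnegative
  because \<open>d / (1 - d)\<close> increases with \<open>d\<close> and \<open>a\<close> is the least coordinate. The vertex \<open>x\<close> is lost, so the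
  number of lattice points drops.
\<close>
lemma smaller_triangle:
  fixes x y z u :: "'a::euclidean_space"
  assumes M: "is_lattice M" and xyz: "x \<in> M" "y \<in> M" "z \<in> M" and u: "u \<in> M"
    and indep: "\<And>r s t. r + s + t = 0 \<Longrightarrow> r *\<^sub>R x + s *\<^sub>R y + t *\<^sub>R z = 0 \<Longrightarrow> r = 0 \<and> s = 0 \<and> t = (0::real)"
    and ueq: "u = a *\<^sub>R x + b *\<^sub>R y + c *\<^sub>R z"
    and abc: "0 \<le> a" "a \<le> b" "a \<le> c" "b < 1" "c < 1" "a + b + c = 2"
  obtains q a' b' c' where "q \<in> M"
    "\<And>r s t. r + s + t = 0 \<Longrightarrow> r *\<^sub>R q + s *\<^sub>R y + t *\<^sub>R z = 0 \<Longrightarrow> r = 0 \<and> s = 0 \<and> t = (0::real)"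
    "u = a' *\<^sub>R q + b' *\<^sub>R y + c' *\<^sub>R z" "0 \<le> a'" "0 \<le> b'" "0 \<le> c'" "a' + b' + c' = 2"
    "convex hull {q, y, z} \<subseteq> convex hull {x, y, z}"
    "card (convex hull {q, y, z} \<inter> M) < card (convex hull {x, y, z} \<inter> M)"
proof -
  define q where "q = x + y + z - u"
  have q: "q = (1 - a) *\<^sub>R x + (1 - b) *\<^sub>R y + (1 - c) *\<^sub>R z"
    unfolding q_def ueq by (simp add: algebra_simps)
  \<comment> \<open>\<open>a = 0\<close> is impossible, since \<open>b + c < 2\<close>\<close>
  have a: "0 < a" "a < 1" using abc by linarith+
  have expand: "r *\<^sub>R q + s *\<^sub>R y + t *\<^sub>R z =
      (r * (1 - a)) *\<^sub>R x + (s + r * (1 - b)) *\<^sub>R y + (t + r * (1 - c)) *\<^sub>R z" for r s t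
    unfolding q by (simp add: algebra_simps)
  have sum_one: "r * (1 - a) + (s + r * (1 - b)) + (t + r * (1 - c)) = r + s + t" for r s t :: real
  proof -
    have c: "c = 2 - a - b" using abc by simp
    show ?thesis unfolding c by (simp add: algebra_simps)
  qed
  have sub: "convex hull {q, y, z} \<subseteq> convex hull {x, y, z}"
  proof (rule hull_minimal)
    have "q \<in> convex hull {x, y, z}" unfolding convex_hull_3
      by (intro CollectI exI[of _ "1 - a"] exI[of _ "1 - b"] exI[of _ "1 - c"]) (use q abc a in auto)
    then show "{q, y, z} \<subseteq> convex hull {x, y, z}" by (auto intro: hull_inc)
  qed (rule convex_convex_hull)
  have x_notin: "x \<notin> convex hull {q, y, z}"
  proof
    assume "x \<in> convex hull {q, y, z}"
    then obtain r s t where rst: "0 \<le> r" "0 \<le> s" "0 \<le> t" "r + s + t = 1"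
      "x = r *\<^sub>R q + s *\<^sub>R y + t *\<^sub>R z" unfolding convex_hull_3 by auto
    have combination: "(r * (1 - a) - 1) *\<^sub>R x + (s + r * (1 - b)) *\<^sub>R y + (t + r * (1 - c)) *\<^sub>R z = 0"
      using rst(5) unfolding expand by (simp add: algebra_simps)
    have "(r * (1 - a) - 1) + (s + r * (1 - b)) + (t + r * (1 - c)) = 0"
      using sum_one[of r s t] rst(4) by linarith
    then have "r * (1 - a) = 1" using indep[OF _ combination] by simp
    moreover have "r * (1 - a) \<le> 1 * (1 - a)" using rst a by (intro mult_right_mono) auto
    ultimately show False using a by simp
  qed
  define t where "t = a / (1 - a)"
  have t: "0 \<le> t" "t * (1 - a) = a" unfolding t_def using a by auto
  have ratio: "t * (1 - d) \<le> d" if "a \<le> d" for d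
  proof -
    have "t * (1 - d) \<le> t * (1 - a)" using that t(1) by (intro mult_left_mono) auto
    then show ?thesis using t(2) that by linarith
  qed
  show thesis
  proof (rule that[of q t "b - t * (1 - b)" "c - t * (1 - c)"])
    show "q \<in> M" unfolding q_def using M xyz u by (intro lattice_diff lattice_add)
    show "r = 0 \<and> s = 0 \<and> t = 0" if rst: "r + s + t = 0" "r *\<^sub>R q + s *\<^sub>R y + t *\<^sub>R z = 0" for r s t :: real
    proof -
      have "r * (1 - a) = 0 \<and> s + r * (1 - b) = 0 \<and> t + r * (1 - c) = 0"
        using rst indep[of "r * (1 - a)" "s + r * (1 - b)" "t + r * (1 - c)"]
        unfolding expand sum_one by blast
      then show ?thesis using a by auto
    qed
    show "u = t *\<^sub>R q + (b - t * (1 - b)) *\<^sub>R y + (c - t * (1 - c)) *\<^sub>R z"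
      unfolding expand t(2) ueq by simp
    show "t + (b - t * (1 - b)) + (c - t * (1 - c)) = 2"
      using sum_one[of t "b - t * (1 - b)" "c - t * (1 - c)"] t(2) abc by simp
    show "0 \<le> b - t * (1 - b)" "0 \<le> c - t * (1 - c)" using ratio abc by simp_all
    show "0 \<le> t" by (rule t(1))
    show "convex hull {q, y, z} \<subseteq> convex hull {x, y, z}" by (rule sub)
    show "card (convex hull {q, y, z} \<inter> M) < card (convex hull {x, y, z} \<inter> M)"
    proof (rule psubset_card_mono)
      show "finite (convex hull {x, y, z} \<inter> M)"
        by (intro finite_bounded_lattice[OF M] bounded_convex_hull) auto
      have "x \<in> convex hull {x, y, z} \<inter> M" using xyz by (auto intro: hull_inc)
      then show "convex hull {q, y, z} \<inter> M \<subset> convex hull {x, y, z} \<inter> M" using sub x_notin by blast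
    qed
  qed
qed

text \<open>
  Descent on the number of lattice points of the triangle, until some coordinate reaches \<open>1\<close> and the
  corresponding vertex can be split off.
\<close>
lemma split_triangle_point:
  fixes x y z u :: "'a::euclidean_space"
  assumes M: "is_lattice M" and "x \<in> M" "y \<in> M" "z \<in> M" and u: "u \<in> M"
    and "\<And>r s t. r + s + t = 0 \<Longrightarrow> r *\<^sub>R x + s *\<^sub>R y + t *\<^sub>R z = 0 \<Longrightarrow> r = 0 \<and> s = 0 \<and> t = (0::real)"
    and "u = a *\<^sub>R x + b *\<^sub>R y + c *\<^sub>R z"
    and "0 \<le> a" "0 \<le> b" "0 \<le> c" "a + b + c = 2"
  shows "\<exists>p \<in> convex hull {x, y, z} \<inter> M. u - p \<in> convex hull {x, y, z}"
  using assms(2-4,6-)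
proof (induction "card (convex hull {x, y, z} \<inter> M)" arbitrary: x y z a b c rule: less_induct)
  case (less x y z a b c)
  have vertex: ?case if "p \<in> {x, y, z}" "u - p = r *\<^sub>R x + s *\<^sub>R y + t *\<^sub>R z"
    "0 \<le> r" "0 \<le> s" "0 \<le> t" "r + s + t = 1" for p r s t
  proof -
    have "u - p \<in> convex hull {x, y, z}" unfolding convex_hull_3 using that by blast
    moreover have "p \<in> convex hull {x, y, z} \<inter> M" using that(1) less.prems(1-3) by (auto intro: hull_inc)
    ultimately show ?thesis by blast
  qed
  have descend: ?case if hull: "convex hull {x', y', z'} = convex hull {x, y, z}"
    and M': "x' \<in> M" "y' \<in> M" "z' \<in> M"
    and ind: "\<And>r s t. r + s + t = 0 \<Longrightarrow> r *\<^sub>R x' + s *\<^sub>R y' + t *\<^sub>R z' = 0 \<Longrightarrow> r = 0 \<and> s = 0 \<and> t = (0::real)"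
    and u': "u = a' *\<^sub>R x' + b' *\<^sub>R y' + c' *\<^sub>R z'"
    and abc': "0 \<le> a'" "a' \<le> b'" "a' \<le> c'" "b' < 1" "c' < 1" "a' + b' + c' = 2"
    for x' y' z' a' b' c'
  proof -
    obtain q a'' b'' c'' where q: "q \<in> M"
    "\<And>r s t. r + s + t = 0 \<Longrightarrow> r *\<^sub>R q + s *\<^sub>R y' + t *\<^sub>R z' = 0 \<Longrightarrow> r = 0 \<and> s = 0 \<and> t = (0::real)"
    "u = a'' *\<^sub>R q + b'' *\<^sub>R y' + c'' *\<^sub>R z'" "0 \<le> a''" "0 \<le> b''" "0 \<le> c''" "a'' + b'' + c'' = 2"
    "convex hull {q, y', z'} \<subseteq> convex hull {x', y', z'}"
    "card (convex hull {q, y', z'} \<inter> M) < card (convex hull {x', y', z'} \<inter> M)"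
      using smaller_triangle[OF M M' u ind u' abc'] by blast
    have "\<exists>p \<in> convex hull {q, y', z'} \<inter> M. u - p \<in> convex hull {q, y', z'}"
      by (rule less.hyps[OF _ q(1) M'(2,3) q(2-7)]) (use q(9) hull in simp)
    then show ?thesis using q(8) hull by blast
  qed
  note ind = less.prems(4) and eq = less.prems(5) and nonneg = less.prems(6-9) and in_M = less.prems(1-3)
  consider "1 \<le> a" | "1 \<le> b" | "1 \<le> c"
    | "a \<le> b" "a \<le> c" "b < 1" "c < 1" | "b \<le> a" "b \<le> c" "a < 1" "c < 1"
    | "c \<le> a" "c \<le> b" "a < 1" "b < 1" by linarith
  then show ?case
  proof cases
    case 1
    then show ?thesis by (intro vertex[of x "a - 1" b c]) (use eq nonneg in \<open>auto simp: algebra_simps\<close>)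
  next
    case 2
    then show ?thesis by (intro vertex[of y a "b - 1" c]) (use eq nonneg in \<open>auto simp: algebra_simps\<close>)
  next
    case 3
    then show ?thesis by (intro vertex[of z a b "c - 1"]) (use eq nonneg in \<open>auto simp: algebra_simps\<close>)
  next
    case 4
    show ?thesis by (rule descend[OF refl in_M ind eq]) (use 4 nonneg in auto)
  next
    case 5
    have ind': "s = 0 \<and> r = 0 \<and> t = 0" if "s + r + t = 0" "s *\<^sub>R y + r *\<^sub>R x + t *\<^sub>R z = 0" for r s t :: real
      using ind[of r s t] that by (auto simp: algebra_simps)
    show ?thesis
    proof (rule descend[OF _ in_M(2,1,3) ind'])
      show "convex hull {y, x, z} = convex hull {x, y, z}" by (simp add: insert_commute)
      show "u = b *\<^sub>R y + a *\<^sub>R x + c *\<^sub>R z" using eq by (simp add: add.commute)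
    qed (use 5 nonneg in simp_all)
  next
    case 6
    have ind': "t = 0 \<and> s = 0 \<and> r = 0" if "t + s + r = 0" "t *\<^sub>R z + s *\<^sub>R y + r *\<^sub>R x = 0" for r s t :: real
      using ind[of r s t] that by (auto simp: algebra_simps)
    show ?thesis
    proof (rule descend[OF _ in_M(3,2,1) ind'])
      show "convex hull {z, y, x} = convex hull {x, y, z}" by (simp add: insert_commute)
      show "u = c *\<^sub>R z + b *\<^sub>R y + a *\<^sub>R x" using eq by (simp add: algebra_simps)
    qed (use 6 nonneg in simp_all)
  qed
qed

section \<open>Integral closedness\<close>

lemma lattice_simplex_hull:
  assumes M: "is_lattice M" and P: "lattice_simplex M P"
  shows "lattice_simplex_vertices M (vertices P)" "P = convex hull (vertices P)"
proof -
  obtain S where S: "finite S" "S \<subseteq> M" "P = convex hull S" and dim: "aff_dim P = int DIM('a)"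
    and card: "card (vertices P) = DIM('a) + 1"
    using P unfolding lattice_simplex_def lattice_polytope_def by auto
  have "compact P" using S by (simp add: finite_imp_compact_convex_hull)
  then show hull: "P = convex hull (vertices P)"
    unfolding vertices_def using Krein_Milman_Minkowski S(3) convex_convex_hull by blast
  have "vertices P \<subseteq> S" unfolding vertices_def S(3) using extreme_point_of_convex_hull by blast
  moreover have "aff_dim (vertices P) = int DIM('a)" using dim hull aff_dim_convex_hull by metis
  ultimately show "lattice_simplex_vertices M (vertices P)"
    using M S card finite_subset[of "vertices P" S]
    by unfold_locales (auto simp: affine_independent_iff_card)
qed

context lattice_simplex_vertices
begin

lemma split_dilate_point_dim_two:
  assumes dim: "DIM('a) = 2" and a: "\<forall>v\<in>V. 0 \<le> a v" "sum a V = 2" and u: "(\<Sum>v\<in>V. a v *\<^sub>R v) \<in> M"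
  shows "\<exists>p \<in> dilate 1 \<inter> M. (\<Sum>v\<in>V. a v *\<^sub>R v) - p \<in> dilate 1"
proof -
  have "card V = 3" using card_V dim by simp
  then obtain x y z where V: "V = {x, y, z}" and ne: "x \<noteq> y" "y \<noteq> z" "x \<noteq> z"
    by (auto simp: card_3_iff)
  have indep: "r = 0 \<and> s = 0 \<and> t = 0" if "r + s + t = 0" "r *\<^sub>R x + s *\<^sub>R y + t *\<^sub>R z = 0" for r s t :: real
  proof -
    define U where "U = (\<lambda>v. if v = x then r else if v = y then s else t)"
    have U: "U x = r" "U y = s" "U z = t" unfolding U_def using ne by auto
    have "sum U V = 0" "(\<Sum>v\<in>V. U v *\<^sub>R v) = 0"
      unfolding V using ne that U by (simp_all add: add.assoc)
    then have "\<forall>v\<in>V. U v = 0"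
      using V_indep affine_dependent_explicit_finite[OF finite_V] by blast
    then show ?thesis using U V by auto
  qed
  have "\<exists>p \<in> convex hull {x, y, z} \<inter> M. (\<Sum>v\<in>V. a v *\<^sub>R v) - p \<in> convex hull {x, y, z}"
  proof (rule split_triangle_point[OF lattice _ _ _ u indep])
    show "(\<Sum>v\<in>V. a v *\<^sub>R v) = a x *\<^sub>R x + a y *\<^sub>R y + a z *\<^sub>R z"
      unfolding V using ne by (simp add: add.assoc)
    show "a x + a y + a z = 2" using a(2) ne unfolding V by (simp add: add.assoc)
  qed (use V_in_M a(1) in \<open>simp_all add: V\<close>)
  then show ?thesis using dilate_one V by simp
qed

text \<open>
  A coordinate of at least \<open>1\<close> allows a vertex to be split off, so only points all of whose
  coordinates are smaller than \<open>1\<close> matter.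
\<close>
lemma integrally_closed_if_split:
  assumes split: "\<And>a r. \<forall>v\<in>V. 0 \<le> a v \<Longrightarrow> \<forall>v\<in>V. a v < 1 \<Longrightarrow> sum a V = real (r + 1) \<Longrightarrow> 0 < r \<Longrightarrow>
     (\<Sum>v\<in>V. a v *\<^sub>R v) \<in> M \<Longrightarrow>
     \<exists>p \<in> dilate 1 \<inter> M. (\<Sum>v\<in>V. a v *\<^sub>R v) - p \<in> dilate (real r)"
  shows "integrally_closed M (convex hull V)"
  unfolding integrally_closed_def
proof (intro allI impI)
  fix r :: nat assume r: "0 < r"
  have scale: "(\<lambda>x. real m *\<^sub>R x) ` (convex hull V) = dilate (real m)" if "0 < m" for m
    using dilate_image[of "real m"] that by simp
  have "(dilate 1 \<inter> M) + (dilate (real r) \<inter> M) = dilate (real (r + 1)) \<inter> M"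
  proof (intro subset_antisym subsetI)
    fix x assume "x \<in> (dilate 1 \<inter> M) + (dilate (real r) \<inter> M)"
    then obtain p q where "p \<in> dilate 1 \<inter> M" "q \<in> dilate (real r) \<inter> M" "x = p + q"
      by (auto elim: set_plus_elim)
    then show "x \<in> dilate (real (r + 1)) \<inter> M"
      using dilate_add[of p 1 q "real r"] lattice_add[OF lattice] by (simp add: add.commute)
  next
    fix x assume x: "x \<in> dilate (real (r + 1)) \<inter> M"
    then obtain a where a: "\<forall>v\<in>V. 0 \<le> a v" "sum a V = real (r + 1)" "x = (\<Sum>v\<in>V. a v *\<^sub>R v)"
      unfolding dilate_def by auto
    have "\<exists>p \<in> dilate 1 \<inter> M. x - p \<in> dilate (real r)"
    proof (cases "\<forall>v\<in>V. a v < 1")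
      case True
      then show ?thesis using split a r x by blast
    next
      case False
      then obtain v where v: "v \<in> V" "1 \<le> a v" by force
      then show ?thesis using subtract_vertex[OF a(1,2) v] V_in_M a(3) by auto
    qed
    then obtain p where p: "p \<in> dilate 1 \<inter> M" "x - p \<in> dilate (real r)" by blast
    then have "x - p \<in> M" using lattice_diff[OF lattice] x by blast
    then have "p + (x - p) \<in> (dilate 1 \<inter> M) + (dilate (real r) \<inter> M)"
      using p by (intro set_plus_intro) auto
    then show "x \<in> (dilate 1 \<inter> M) + (dilate (real r) \<inter> M)" by simp
  qed
  then show "(convex hull V \<inter> M) + ((\<lambda>x. real r *\<^sub>R x) ` (convex hull V) \<inter> M)
      = (\<lambda>x. real (r + 1) *\<^sub>R x) ` (convex hull V) \<inter> M"
    using scale[of r] scale[of "r + 1"] r by (simp add: dilate_one)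
qed

end

theorem theorem1p5:
  fixes M P :: "'a::euclidean_space set"
  assumes "is_lattice M"
    and "lattice_simplex M P"
    and "DIM('a) = 2 \<or>
         (DIM('a) \<ge> 3 \<and> Gamma_polytope M P \<ge> 2 / 3 * real DIM('a) - 1)"
    and "real (min_lattice_length M P) \<ge> Gamma_polytope M P + 1"
  shows "integrally_closed M P"
proof -
  define V where "V = vertices P"
  have P: "P = convex hull V" unfolding V_def using assms(1,2) by (rule lattice_simplex_hull)
  interpret lattice_simplex_vertices M V
    unfolding V_def using assms(1,2) by (rule lattice_simplex_hull)
  show ?thesis unfolding P
  proof (rule integrally_closed_if_split)
    fix a :: "'a \<Rightarrow> real" and r :: nat
    assume a: "\<forall>v\<in>V. 0 \<le> a v" "\<forall>v\<in>V. a v < 1" "sum a V = real (r + 1)"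
      and r: "0 < r" and u: "(\<Sum>v\<in>V. a v *\<^sub>R v) \<in> M"
    show "\<exists>p \<in> dilate 1 \<inter> M. (\<Sum>v\<in>V. a v *\<^sub>R v) - p \<in> dilate (real r)"
    proof (cases "DIM('a) = 2")
      case True
      have "V \<noteq> {}" using card_V by auto
      \<comment> \<open>three coordinates smaller than \<open>1\<close> have sum smaller than \<open>3\<close>, so only the double of the triangle occurs\<close>
      then have "sum a V < (\<Sum>v\<in>V. 1)" using a(2) finite_V by (intro sum_strict_mono) auto
      then have "real (r + 1) < 3" using a(3) card_V True by simp
      then have "r = 1" using r by simp
      then show ?thesis using split_dilate_point_dim_two[OF True a(1) _ u] a(3) by simp
    next
      case False
      then have "\<exists>p \<in> dilate 1 \<inter> M. (\<Sum>v\<in>V. a v *\<^sub>R v) - p \<in> dilate (real (r + 1) - 1)"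
        using assms(3,4) r unfolding P by (intro split_dilate_point a u) auto
      then show ?thesis by simp
    qed
  qed
qed

end
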